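(* Let $\Gamma$ be a cofinite discrete subgroup of $\mathrm{PSL}_2(\mathbb R)$, let $\tilde\Gamma=\mathrm{pr}^{-1}(\Gamma)$ be the corresponding cofinite discrete subgroup of $\tilde G$, and let $k,\lambda\in\mathbb C$. If $\tilde{\mathcal E}_k(\tilde\Gamma,\lambda)^{\tilde Z}$ contains a non-zero element $f$, then $k\in2\mathbb Z$ and $\partial_\vartheta f(z,\vartheta)=ik\,f(z,\vartheta)$. If $k\in2\mathbb Z$, then the elements $f\in\tilde E_k(\tilde\Gamma,\lambda)$ correspond bijectively to the Maass forms $F\in E_k(\Gamma,\lambda)$ by $$f(z,\vartheta)=y^{k/2}F(z)\,e^{ik\vartheta}\qquad(y=\mathrm{Im}\,z).$$
   Context: Universal covering group. Let $\mathfrak H$ be the upper half-plane. For $g=\begin{pmatrix}a&b\\c&d\end{pmatrix}\in\mathrm{SL}_2(\mathbb R)$ let $\tilde g:\mathfrak H\times\mathbb R\to\mathfrak H\times\mathbb R$ be $(z,\vartheta)\mapsto\bigl(\frac{az+b}{cz+d},\vartheta-\arg(cz+d)\bigr)$ with $-\pi<\arg\le\pi$. $\tilde G$ is the group of operators on $\mathfrak H\times\mathbb R$ generated by all $\tilde g$; it is the universal covering group of $\mathrm{SL}_2(\mathbb R)$ and $\mathrm{PSL}_2(\mathbb R)$, with covering homomorphism $\mathrm{pr}:\tilde G\to\mathrm{PSL}_2(\mathbb R)$, $\mathrm{pr}(\tilde g)=\pm g$. It is identified with $\mathfrak H\times\mathbb R$ as a manifold via $h\mapsto h(i,0)$; functions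 on $\tilde G$ are written $f(z,\vartheta)$, $z=x+iy$. The element $\zeta=k(\pi)$ acts by $(z,\vartheta)\mapsto(z,\vartheta+\pi)$ and generates the centre $\tilde Z$ of $\tilde G$. Groups act on functions by left translation, $(f|\gamma)(z,\vartheta)=f(\gamma(z,\vartheta))$; superscripts $\tilde Z$, $\tilde\Gamma$ denote invariants. Cusps. For each cusp $\kappa$ of $\Gamma$ let $\Gamma_\kappa$ be its stabilizer, $T=\{\pm\begin{pmatrix}1&n\\0&1\end{pmatrix}:n\in\mathbb Z\}$. Elements $g_\kappa\in\mathrm{PSL}_2(\mathbb R)$ are fixed with $\kappa=g_\kappa\infty$, $g_\kappa^{-1}\Gamma_\kappa g_\kappa=T$ and $g_{\gamma\kappa}\in\gamma g_\kappa T$ for $\gamma\in\Gamma$; $\tilde g_\kappa\in\tilde G$ is the lift of $g_\kappa$ (for a choice of matrix representative). The cusps of $\tilde\Gamma$ are those of $\Gamma$. Spaces on $\tilde G$. Let $\mathbf W=\partial_\vartheta$ and $\omega=-y^2\partial_y^2-y^2\partial_x^2+y\,\partial_x\partial_\vartheta$. $\tilde{\mathcal E}_k(\tilde\Gamma,\lambda)$ is the space of smooth $f:\mathfrak H\times\mathbb R\to\mathbb C$ such that (a) $\omega f=\lambda f$; (b) $(\mathbf W-ik)^nf=0$ for some $n\in\mathbb N$; (c) there is $a\in\mathbb R$ such that for all compact sets $X,\Theta\subset\mathbb R$ and all cusps $\kappa$, $f(\tilde g_\kappa(x+iy,\vartheta))=O(e^{ay})$ as $y\to\infty$, uniformly in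 $x\in X$, $\vartheta\in\Theta$. Put $\tilde E_k(\tilde\Gamma,\lambda)=\tilde{\mathcal E}_k(\tilde\Gamma,\lambda)^{\tilde\Gamma}$. Spaces on $\mathfrak H$. For $k\in2\mathbb Z$ let $\bigl(F|_k\begin{pmatrix}a&b\\c&d\end{pmatrix}\bigr)(z)=(cz+d)^{-k}F\bigl(\frac{az+b}{cz+d}\bigr)$ and $L_k=-y^2\partial_x^2-y^2\partial_y^2+iky\,\partial_x-ky\,\partial_y+\frac k2(1-\frac k2)$. $E_k(\Gamma,\lambda)$ is the space of smooth $F:\mathfrak H\to\mathbb C$ with $L_kF=\lambda F$, $F|_k\gamma=F$ for all $\gamma\in\Gamma$, and for which there is $a\in\mathbb R$ such that for all cusps $\kappa$ of $\Gamma$, $F(g_\kappa(x+iy))=O(e^{ay})$ as $y\to\infty$, uniformly for $x$ in compact sets. *)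

theory Defs
  imports "HOL-Analysis.Analysis" "HOL-Algebra.Bij" "HOL-Algebra.Generated_Groups"
begin

section \<open>The groups \<open>SL\<^sub>2(\<real>)\<close> and \<open>PSL\<^sub>2(\<real>)\<close>\<close>

definition SL2R :: "(real^2^2) monoid"
  where "SL2R = \<lparr>carrier = {A. det A = 1}, mult = (**), one = mat 1\<rparr>"

definition PSL2R :: "(real^2^2) set monoid"
  where "PSL2R = SL2R Mod {mat 1, - mat 1}"

definition psl :: "real^2^2 \<Rightarrow> (real^2^2) set"
  where "psl A = {mat 1, - mat 1} #>\<^bsub>SL2R\<^esub> A"

definition mat2 :: "real \<Rightarrow> real \<Rightarrow> real \<Rightarrow> real \<Rightarrow> real^2^2"
  where "mat2 a b c d = vector [vector [a, b], vector [c, d]]"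

text \<open>The quotient topology: elements of \<^const>\<open>PSL2R\<close> are the cosets \<open>{A, -A}\<close>, so the
  preimage in \<open>SL\<^sub>2(\<real>)\<close> of a set of cosets is its union.\<close>

definition PSL2R_topology :: "(real^2^2) set topology"
  where "PSL2R_topology = topology (\<lambda>U. U \<subseteq> carrier PSL2R \<and>
           openin (top_of_set (carrier SL2R)) (\<Union>U))"


section \<open>Actions on the upper half-plane and on its boundary\<close>

definition UHP :: "complex set"
  where "UHP = {z. Im z > 0}"

definition aut_factor :: "real^2^2 \<Rightarrow> complex \<Rightarrow> complex"
  where "aut_factor A z = of_real (A$2$1) * z + of_real (A$2$2)"

definition moebius_map :: "real^2^2 \<Rightarrow> complex \<Rightarrow> complex"
  where "moebius_map A z = (of_real (A$1$1) * z + of_real (A$1$2)) / aut_factor A z"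

datatype boundary = Finite real | Infinity

fun boundary_moebius :: "real^2^2 \<Rightarrow> boundary \<Rightarrow> boundary" where
  "boundary_moebius A (Finite x) =
     (if A$2$1 * x + A$2$2 = 0 then Infinity
      else Finite ((A$1$1 * x + A$1$2) / (A$2$1 * x + A$2$2)))"
| "boundary_moebius A Infinity =
     (if A$2$1 = 0 then Infinity else Finite (A$1$1 / A$2$1))"

text \<open>In the next two definitions, the choice of the representative is irrelevant, since \<open>A\<close> and
  \<open>-A\<close> act in the same way.\<close>

definition psl_act :: "(real^2^2) set \<Rightarrow> complex \<Rightarrow> complex"
  where "psl_act \<gamma> z = moebius_map (SOME A. A \<in> \<gamma>) z"

definition psl_boundary_act :: "(real^2^2) set \<Rightarrow> boundary \<Rightarrow> boundary"
  where "psl_boundary_act \<gamma> \<kappa> = boundary_moebius (SOME A. A \<in> \<gamma>) \<kappa>"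


section \<open>Cofinite discrete subgroups and their cusps\<close>

definition hyperbolic_area :: "complex set \<Rightarrow> ennreal"
  where "hyperbolic_area D = (\<integral>\<^sup>+ z\<in>D. ennreal (1 / (Im z)\<^sup>2) \<partial>lborel)"

text \<open>Cofinite: the quotient of the upper half-plane has finite hyperbolic area. The area of the
  quotient is that of any Borel set of representatives for the orbits.\<close>

definition cofinite_discrete_subgroup :: "(real^2^2) set set \<Rightarrow> bool"
  where "cofinite_discrete_subgroup \<Gamma> \<longleftrightarrow>
     subgroup \<Gamma> PSL2R \<and>
     subtopology PSL2R_topology \<Gamma> = discrete_topology \<Gamma> \<and>
     (\<exists>D \<in> sets borel. D \<subseteq> UHP \<and> (\<forall>z\<in>UHP. \<exists>!w. w \<in> D \<and> (\<exists>\<gamma>\<in>\<Gamma>. w = psl_act \<gamma> z)) \<and>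
        hyperbolic_area D < \<infinity>)"

definition parabolic :: "(real^2^2) set \<Rightarrow> bool"
  where "parabolic \<gamma> \<longleftrightarrow> \<gamma> \<in> carrier PSL2R \<and> \<gamma> \<noteq> \<one>\<^bsub>PSL2R\<^esub> \<and> (\<forall>A\<in>\<gamma>. \<bar>trace A\<bar> = 2)"

definition cusps :: "(real^2^2) set set \<Rightarrow> boundary set"
  where "cusps \<Gamma> = {\<kappa>. \<exists>\<gamma>\<in>\<Gamma>. parabolic \<gamma> \<and> psl_boundary_act \<gamma> \<kappa> = \<kappa>}"

definition cusp_stabilizer :: "(real^2^2) set set \<Rightarrow> boundary \<Rightarrow> (real^2^2) set set"
  where "cusp_stabilizer \<Gamma> \<kappa> = {\<gamma>\<in>\<Gamma>. psl_boundary_act \<gamma> \<kappa> = \<kappa>}"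

definition T_infty :: "(real^2^2) set set"
  where "T_infty = {psl (mat2 1 (of_int n) 0 1) | n::int. True}"

definition cusp_scaling :: "(real^2^2) set set \<Rightarrow> (boundary \<Rightarrow> (real^2^2) set) \<Rightarrow> bool"
  where "cusp_scaling \<Gamma> g \<longleftrightarrow> (\<forall>\<kappa>\<in>cusps \<Gamma>.
     g \<kappa> \<in> carrier PSL2R \<and>
     psl_boundary_act (g \<kappa>) Infinity = \<kappa> \<and>
     (\<lambda>\<gamma>. inv\<^bsub>PSL2R\<^esub> (g \<kappa>) \<otimes>\<^bsub>PSL2R\<^esub> \<gamma> \<otimes>\<^bsub>PSL2R\<^esub> g \<kappa>) ` cusp_stabilizer \<Gamma> \<kappa> = T_infty \<and>
     (\<forall>\<gamma>\<in>\<Gamma>. \<exists>t\<in>T_infty. g (psl_boundary_act \<gamma> \<kappa>) = \<gamma> \<otimes>\<^bsub>PSL2R\<^esub> g \<kappa> \<otimes>\<^bsub>PSL2R\<^esub> t))"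


section \<open>The universal covering group\<close>

definition UHPxR :: "(complex \<times> real) set"
  where "UHPxR = UHP \<times> UNIV"

text \<open>Operators and complex-valued functions on \<^const>\<open>UHPxR\<close> are extensional, as in
  \<^const>\<open>BijGroup\<close>, so that equality of them is equality on \<^const>\<open>UHPxR\<close>.\<close>

definition lift :: "real^2^2 \<Rightarrow> complex \<times> real \<Rightarrow> complex \<times> real"
  where "lift A = (\<lambda>(z, \<theta>) \<in> UHPxR. (moebius_map A z, \<theta> - Arg (aut_factor A z)))"

definition Gt :: "(complex \<times> real \<Rightarrow> complex \<times> real) monoid"
  where "Gt = subgroup_generated (BijGroup UHPxR) (lift ` carrier SL2R)"

text \<open>Existence and uniqueness of this homomorphism are shown in \<open>ex1_pr\<close> below.\<close>

definition pr :: "(complex \<times> real \<Rightarrow> complex \<times> real) \<Rightarrow> (real^2^2) set"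
  where "pr = (THE \<phi>. \<phi> \<in> extensional (carrier Gt) \<and> \<phi> \<in> hom Gt PSL2R \<and>
                 (\<forall>A\<in>carrier SL2R. \<phi> (lift A) = psl A))"

definition full_preimage ::
    "(real^2^2) set set \<Rightarrow> (complex \<times> real \<Rightarrow> complex \<times> real) set"
  where "full_preimage \<Gamma> = {h \<in> carrier Gt. pr h \<in> \<Gamma>}"

definition Zt :: "(complex \<times> real \<Rightarrow> complex \<times> real) set"
  where "Zt = {h \<in> carrier Gt. \<forall>h'\<in>carrier Gt. h \<otimes>\<^bsub>Gt\<^esub> h' = h' \<otimes>\<^bsub>Gt\<^esub> h}"

text \<open>A generator of the centre \<^const>\<open>Zt\<close>.\<close>

definition zeta :: "complex \<times> real \<Rightarrow> complex \<times> real"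
  where "zeta = (\<lambda>(z, \<theta>) \<in> UHPxR. (z, \<theta> + pi))"

definition translate ::
    "(complex \<times> real \<Rightarrow> complex) \<Rightarrow> (complex \<times> real \<Rightarrow> complex \<times> real) \<Rightarrow> complex \<times> real \<Rightarrow> complex"
  where "translate f h = (\<lambda>p \<in> UHPxR. f (h p))"

definition invariants ::
    "(complex \<times> real \<Rightarrow> complex) set \<Rightarrow> (complex \<times> real \<Rightarrow> complex \<times> real) set
     \<Rightarrow> (complex \<times> real \<Rightarrow> complex) set"
  where "invariants V H = {f\<in>V. \<forall>h\<in>H. translate f h = f}"


section \<open>Smooth functions and differential operators\<close>

definition dir_deriv :: "'a::real_normed_vector \<Rightarrow> ('a \<Rightarrow> 'b::real_normed_vector) \<Rightarrow> 'a \<Rightarrow> 'b"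
  where "dir_deriv v f = (\<lambda>x. frechet_derivative f (at x) v)"

primrec Ck_on :: "nat \<Rightarrow> 'a::real_normed_vector set \<Rightarrow> ('a \<Rightarrow> 'b::real_normed_vector) \<Rightarrow> bool"
where
  "Ck_on 0 S f \<longleftrightarrow> continuous_on S f"
| "Ck_on (Suc n) S f \<longleftrightarrow>
     (\<forall>x\<in>S. f differentiable (at x)) \<and> (\<forall>v. Ck_on n S (dir_deriv v f))"

text \<open>Meant for open sets \<open>S\<close> of finite-dimensional spaces.\<close>

definition smooth_on :: "'a::real_normed_vector set \<Rightarrow> ('a \<Rightarrow> 'b::real_normed_vector) \<Rightarrow> bool"
  where "smooth_on S f \<longleftrightarrow> (\<forall>n. Ck_on n S f)"

text \<open>In coordinates \<open>(x + iy, \<theta>)\<close>:\<close>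

abbreviation D_x :: "(complex \<times> real \<Rightarrow> complex) \<Rightarrow> complex \<times> real \<Rightarrow> complex"
  where "D_x \<equiv> dir_deriv (1, 0)"
abbreviation D_y :: "(complex \<times> real \<Rightarrow> complex) \<Rightarrow> complex \<times> real \<Rightarrow> complex"
  where "D_y \<equiv> dir_deriv (\<i>, 0)"
abbreviation D_theta :: "(complex \<times> real \<Rightarrow> complex) \<Rightarrow> complex \<times> real \<Rightarrow> complex"
  where "D_theta \<equiv> dir_deriv (0, 1)"

definition casimir :: "(complex \<times> real \<Rightarrow> complex) \<Rightarrow> complex \<times> real \<Rightarrow> complex"
  where "casimir f = (\<lambda>p. let y = complex_of_real (Im (fst p)) in
     - y\<^sup>2 * D_y (D_y f) p - y\<^sup>2 * D_x (D_x f) p + y * D_x (D_theta f) p)"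

definition L_op :: "int \<Rightarrow> (complex \<Rightarrow> complex) \<Rightarrow> complex \<Rightarrow> complex"
  where "L_op k F = (\<lambda>z. let y = complex_of_real (Im z); \<kappa> = complex_of_int k in
     - y\<^sup>2 * dir_deriv 1 (dir_deriv 1 F) z - y\<^sup>2 * dir_deriv \<i> (dir_deriv \<i> F) z
     + \<i> * \<kappa> * y * dir_deriv 1 F z - \<kappa> * y * dir_deriv \<i> F z + \<kappa> / 2 * (1 - \<kappa> / 2) * F z)"


section \<open>Spaces of functions on the covering group and on the upper half-plane\<close>

text \<open>\<open>Ecal \<Gamma> m k lam\<close> is the space of functions belonging to the full preimage of \<open>\<Gamma>\<close>, whose cusps
  are those of \<open>\<Gamma>\<close>. The family \<open>m\<close> consists of matrices representing the elements \<open>g\<^sub>\<kappa>\<close>.\<close>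

definition Ecal ::
    "(real^2^2) set set \<Rightarrow> (boundary \<Rightarrow> real^2^2) \<Rightarrow> complex \<Rightarrow> complex
     \<Rightarrow> (complex \<times> real \<Rightarrow> complex) set"
  where "Ecal \<Gamma> m k lam = {f \<in> extensional UHPxR.
     smooth_on UHPxR f \<and>
     (\<forall>p\<in>UHPxR. casimir f p = lam * f p) \<and>
     (\<exists>n::nat. \<forall>p\<in>UHPxR. ((\<lambda>h q. D_theta h q - \<i> * k * h q) ^^ n) f p = 0) \<and>
     (\<exists>a::real. \<forall>X Y. compact X \<and> compact Y \<longrightarrow> (\<forall>\<kappa>\<in>cusps \<Gamma>.
        \<exists>C. \<forall>\<^sub>F y in at_top. \<forall>x\<in>X. \<forall>\<theta>\<in>Y.
          norm (f (lift (m \<kappa>) (Complex x y, \<theta>))) \<le> C * exp (a * y)))}"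

definition Etilde ::
    "(real^2^2) set set \<Rightarrow> (boundary \<Rightarrow> real^2^2) \<Rightarrow> complex \<Rightarrow> complex
     \<Rightarrow> (complex \<times> real \<Rightarrow> complex) set"
  where "Etilde \<Gamma> m k lam = invariants (Ecal \<Gamma> m k lam) (full_preimage \<Gamma>)"

definition slash :: "int \<Rightarrow> (complex \<Rightarrow> complex) \<Rightarrow> real^2^2 \<Rightarrow> complex \<Rightarrow> complex"
  where "slash k F A = (\<lambda>z. aut_factor A z powi (- k) * F (moebius_map A z))"

definition maass_forms ::
    "(real^2^2) set set \<Rightarrow> (boundary \<Rightarrow> (real^2^2) set) \<Rightarrow> int \<Rightarrow> complex
     \<Rightarrow> (complex \<Rightarrow> complex) set"
  where "maass_forms \<Gamma> g k lam = {F \<in> extensional UHP.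
     smooth_on UHP F \<and>
     (\<forall>z\<in>UHP. L_op k F z = lam * F z) \<and>
     (\<forall>\<gamma>\<in>\<Gamma>. \<forall>A\<in>\<gamma>. \<forall>z\<in>UHP. slash k F A z = F z) \<and>
     (\<exists>a::real. \<forall>\<kappa>\<in>cusps \<Gamma>. \<forall>X :: real set. compact X \<longrightarrow>
        (\<exists>C. \<forall>\<^sub>F y in at_top. \<forall>x\<in>X.
          norm (F (psl_act (g \<kappa>) (Complex x y))) \<le> C * exp (a * y)))}"


section \<open>Well-definedness\<close>

lemma group_SL2R: "group SL2R"
proof (rule groupI)
  fix A assume A: "A \<in> carrier SL2R"
  then obtain B where B: "A ** B = mat 1" "B ** A = mat 1"
    using invertible_det_nz[of A] by (auto simp: SL2R_def invertible_def)
  have "det A * det B = 1" using det_mul[of A B] B by simp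
  then show "\<exists>B\<in>carrier SL2R. B \<otimes>\<^bsub>SL2R\<^esub> A = \<one>\<^bsub>SL2R\<^esub>"
    using A B by (auto simp: SL2R_def)
qed (auto simp: SL2R_def det_mul matrix_mul_assoc)

lemma det_minus: "det (- A) = det (A :: real^2^2)"
  by (simp add: det_2)

lemma mult_minus: "A ** (- B) = - (A ** B)" "(- A) ** B = - (A ** (B :: real^2^2))"
  by (simp_all add: vec_eq_iff matrix_matrix_mult_def sum_negf)

lemma normal_pm: "{mat 1, - mat 1} \<lhd> SL2R"
proof -
  interpret group SL2R by (rule group_SL2R)
  have "inv\<^bsub>SL2R\<^esub> (- mat 1) = - mat 1"
    by (rule inv_equality) (auto simp: SL2R_def det_minus mult_minus)
  then have "subgroup {mat 1, - mat 1} SL2R"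
    using inv_one by unfold_locales (auto simp: SL2R_def det_minus mult_minus simp del: inv_one)
  then show ?thesis
  proof (rule normalI)
    show "\<forall>A\<in>carrier SL2R. {mat 1, - mat 1} #>\<^bsub>SL2R\<^esub> A = A <#\<^bsub>SL2R\<^esub> {mat 1, - mat 1}"
      by (auto simp: r_coset_def l_coset_def SL2R_def mult_minus)
  qed
qed

lemma psl_eq: "psl A = {A, - A}"
  by (auto simp: psl_def r_coset_def SL2R_def mult_minus)

lemma group_PSL2R: "group PSL2R"
  unfolding PSL2R_def by (rule normal.factorgroup_is_group[OF normal_pm])

lemma carrier_PSL2R: "carrier PSL2R = psl ` carrier SL2R"
  by (auto simp: PSL2R_def FactGroup_def RCOSETS_def psl_def)

lemma psl_mult: "A \<in> carrier SL2R \<Longrightarrow> B \<in> carrier SL2R \<Longrightarrow> psl A \<otimes>\<^bsub>PSL2R\<^esub> psl B = psl (A ** B)"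
  using normal.rcos_sum[OF normal_pm, of A B] by (simp add: PSL2R_def psl_def FactGroup_def SL2R_def)

lemma openin_PSL2R_topology:
  "openin PSL2R_topology U \<longleftrightarrow>
     U \<subseteq> carrier PSL2R \<and> openin (top_of_set (carrier SL2R)) (\<Union>U)"
proof -
  have disj: "\<Union>(U \<inter> V) = \<Union>U \<inter> \<Union>V" if "U \<subseteq> carrier PSL2R" "V \<subseteq> carrier PSL2R" for U V
  proof -
    have "x \<in> \<Union>(U \<inter> V)" if "x \<in> X" "X \<in> U" "x \<in> Y" "Y \<in> V" for x X Y
    proof -
      have "X = psl x" "Y = psl x"
        using that \<open>U \<subseteq> _\<close> \<open>V \<subseteq> _\<close> by (auto simp: carrier_PSL2R psl_eq)
      then show ?thesis using that by auto
    qed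
    then show ?thesis by blast
  qed
  have "istopology (\<lambda>U. U \<subseteq> carrier PSL2R \<and> openin (top_of_set (carrier SL2R)) (\<Union>U))"
    unfolding istopology_def
  proof (intro conjI allI impI)
    fix K assume K: "\<forall>U\<in>K. U \<subseteq> carrier PSL2R \<and> openin (top_of_set (carrier SL2R)) (\<Union> U)"
    then show "\<Union>K \<subseteq> carrier PSL2R" by blast
    have "\<Union>(\<Union>K) = \<Union>(Union ` K)" by blast
    then show "openin (top_of_set (carrier SL2R)) (\<Union>(\<Union>K))"
      using K by (metis (no_types, lifting) imageE openin_Union)
  qed (auto simp: disj)
  then show ?thesis
    unfolding PSL2R_topology_def by (simp add: topology_inverse')
qed

lemma aut_factor_mult:
  "aut_factor (A ** B) z * 1 = (of_real (A$2$1) * (of_real (B$1$1) * z + of_real (B$1$2)) + of_real (A$2$2) * aut_factor B z)"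
  by (simp add: aut_factor_def matrix_matrix_mult_def sum_2 algebra_simps)

lemma aut_factor_nz:
  assumes "det A = 1" "z \<in> UHP" shows "aut_factor A z \<noteq> 0"
proof
  assume "aut_factor A z = 0"
  then have "A$2$1 * Im z = 0" "A$2$1 * Re z + A$2$2 = 0"
    by (auto simp: aut_factor_def complex_eq_iff)
  then show False using assms by (auto simp: UHP_def det_2)
qed

lemma aut_factor_comp:
  assumes "det A = 1" "det B = 1" "z \<in> UHP"
  shows "aut_factor (A ** B) z = aut_factor A (moebius_map B z) * aut_factor B z"
  using aut_factor_nz[of B z] assms aut_factor_mult[of A B z]
  by (simp add: moebius_map_def aut_factor_def[of A] field_simps)

lemma moebius_comp:
  assumes "det A = 1" "det B = 1" "z \<in> UHP"
  shows "moebius_map (A ** B) z = moebius_map A (moebius_map B z)"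
proof -
  have nz: "aut_factor B z \<noteq> 0" using assms aut_factor_nz by blast
  have "moebius_map (A ** B) z = ((of_real (A$1$1) * (of_real (B$1$1) * z + of_real (B$1$2)) + of_real (A$1$2) * aut_factor B z))
     / (aut_factor A (moebius_map B z) * aut_factor B z)"
    unfolding moebius_map_def[of "A ** B"] aut_factor_comp[OF assms]
    by (simp add: aut_factor_def matrix_matrix_mult_def sum_2 algebra_simps)
  also have "\<dots> = moebius_map A (moebius_map B z)"
    using nz by (simp add: moebius_map_def[of A] moebius_map_def[of B] field_simps)
  finally show ?thesis .
qed

lemma moebius_UHP:
  assumes "det A = 1" "z \<in> UHP" shows "moebius_map A z \<in> UHP"
proof -
  have nz: "aut_factor A z \<noteq> 0" using assms aut_factor_nz by blast
  let ?a = "A$1$1" and ?b = "A$1$2" and ?c = "A$2$1" and ?d = "A$2$2"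
  have "Im (moebius_map A z) = (Im ((of_real ?a * z + of_real ?b) * cnj (aut_factor A z))) / (cmod (aut_factor A z))\<^sup>2"
    unfolding moebius_map_def by (subst complex_div_cnj) simp
  also have "Im ((of_real ?a * z + of_real ?b) * cnj (aut_factor A z)) = (?a * ?d - ?b * ?c) * Im z"
    by (simp add: aut_factor_def algebra_simps)
  also have "\<dots> = Im z" using assms by (simp add: det_2)
  finally show ?thesis using assms nz by (simp add: UHP_def)
qed

lemma moebius_mat1 [simp]: "moebius_map (mat 1) z = z"
  by (simp add: moebius_map_def aut_factor_def mat_def)

lemma moebius_minus: "moebius_map (- A) z = moebius_map A z"
proof -
  have "of_real ((- A)$i$1) * z + of_real ((- A)$i$2) = - (of_real (A$i$1) * z + of_real (A$i$2))" for i
    by simp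
  then show ?thesis by (simp only: moebius_map_def aut_factor_def minus_divide_divide)
qed

lemma boundary_moebius_minus: "boundary_moebius (- A) \<kappa> = boundary_moebius A \<kappa>"
proof (cases \<kappa>)
  case (Finite x)
  have "- (A$1$1 * x) - A$1$2 = - (A$1$1 * x + A$1$2)" "- (A$2$1 * x) - A$2$2 = - (A$2$1 * x + A$2$2)" by auto
  then show ?thesis using Finite by (simp add: divide_simps) (simp add: algebra_simps)
qed simp

lemma moebius_inj:
  assumes "det A = 1" "det B = 1" "\<And>z. z \<in> UHP \<Longrightarrow> moebius_map A z = moebius_map B z"
  shows "psl A = psl B"
proof -
  interpret group SL2R by (rule group_SL2R)
  let ?C = "inv\<^bsub>SL2R\<^esub> B ** A"
  have Bi: "inv\<^bsub>SL2R\<^esub> B \<in> carrier SL2R" "inv\<^bsub>SL2R\<^esub> B ** B = mat 1" "B ** inv\<^bsub>SL2R\<^esub> B = mat 1"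
    using inv_closed[of B] l_inv[of B] r_inv[of B] assms by (auto simp: SL2R_def)
  have dC: "det ?C = 1" using Bi assms by (simp add: SL2R_def det_mul)
  have C: "moebius_map ?C z = z" if "z \<in> UHP" for z
  proof -
    have "moebius_map ?C z = moebius_map (inv\<^bsub>SL2R\<^esub> B ** B) z"
      using that Bi(1) assms by (simp add: moebius_comp SL2R_def)
    then show ?thesis using Bi by simp
  qed
  have eq: "of_real (?C$1$1) * z + of_real (?C$1$2) = z * (of_real (?C$2$1) * z + of_real (?C$2$2))"
    if "z \<in> UHP" for z
    using C[OF that] aut_factor_nz[OF dC that] unfolding moebius_map_def aut_factor_def by (simp add: field_simps)
  define a b c d where "a = ?C$1$1" and "b = ?C$1$2" and "c = ?C$2$1" and "d = ?C$2$2"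
  have 1: "b = - c" "a = d"
    using eq[of \<i>] by (auto simp: UHP_def complex_eq_iff a_def b_def c_def d_def)
  have 2: "b = - 4 * c"
    using eq[of "2 * \<i>"] by (auto simp: UHP_def complex_eq_iff a_def b_def c_def d_def)
  have "b = 0" "c = 0" using 1 2 by auto
  moreover have "a * d = 1 + b * c" using dC by (simp add: det_2 a_def b_def c_def d_def)
  ultimately have "a = 1 \<or> a = -1" using 1 by (metis add.right_neutral mult_zero_left square_eq_1_iff)
  then have "?C = mat 1 \<or> ?C = - mat 1"
    using 1 \<open>b = 0\<close> \<open>c = 0\<close> by (auto simp: vec_eq_iff forall_2 mat_def a_def b_def c_def d_def)
  moreover have "B ** ?C = A" using Bi by (simp add: matrix_mul_assoc)
  ultimately have "A = B \<or> A = - B" by (metis matrix_mul_rid mult_minus(1))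
  then show ?thesis by (auto simp: psl_eq)
qed


lemma UHPxR_iff [simp]: "(z, t) \<in> UHPxR \<longleftrightarrow> z \<in> UHP"
  by (simp add: UHPxR_def)

lemma lift_apply: "z \<in> UHP \<Longrightarrow> lift A (z, t) = (moebius_map A z, t - Arg (aut_factor A z))"
  by (simp add: lift_def)

lemma lift_Bij:
  assumes "A \<in> carrier SL2R" shows "lift A \<in> Bij UHPxR"
proof -
  interpret group SL2R by (rule group_SL2R)
  let ?B = "inv\<^bsub>SL2R\<^esub> A"
  have B: "?B \<in> carrier SL2R" "?B ** A = mat 1" "A ** ?B = mat 1"
    using inv_closed[of A] l_inv[of A] r_inv[of A] assms by (auto simp: SL2R_def)
  have 1: "moebius_map ?B (moebius_map A z) = z" "moebius_map A (moebius_map ?B z) = z" if "z \<in> UHP" for z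
    using moebius_comp[of ?B A z] moebius_comp[of A ?B z] that assms B by (auto simp: SL2R_def)
  have 2: "moebius_map ?B z \<in> UHP" "moebius_map A z \<in> UHP" if "z \<in> UHP" for z
    using that assms B by (auto simp: SL2R_def moebius_UHP)
  have "bij_betw (lift A) UHPxR UHPxR"
    by (rule bij_betw_byWitness[where f' = "\<lambda>(z, t). (moebius_map ?B z, t + Arg (aut_factor A (moebius_map ?B z)))"])
       (auto simp: UHPxR_def lift_def 1 2)
  then show ?thesis by (simp add: Bij_def lift_def)
qed

definition covers :: "(complex \<times> real \<Rightarrow> complex \<times> real) \<Rightarrow> real^2^2 \<Rightarrow> bool"
  where "covers h A \<longleftrightarrow> det A = 1 \<and> (\<forall>z\<in>UHP. \<forall>t. fst (h (z, t)) = moebius_map A z)"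

lemma group_Gt: "group Gt"
  unfolding Gt_def by (rule group.group_subgroup_generated[OF group_BijGroup])

lemma lift_in_Gt: "A \<in> carrier SL2R \<Longrightarrow> lift A \<in> carrier Gt"
  unfolding Gt_def carrier_subgroup_generated
  by (rule generate.incl) (auto simp: BijGroup_def lift_Bij)

lemma Gt_Bij: "carrier Gt \<subseteq> Bij UHPxR"
  using group.generate_incl[OF group_BijGroup, of "Bij UHPxR \<inter> lift ` carrier SL2R" UHPxR]
  by (simp add: Gt_def carrier_subgroup_generated BijGroup_def)

lemma Gt_mult: "h \<in> carrier Gt \<Longrightarrow> h' \<in> carrier Gt \<Longrightarrow> h \<otimes>\<^bsub>Gt\<^esub> h' = compose UHPxR h h'"
  using Gt_Bij by (auto simp: Gt_def BijGroup_def)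

lemma covers_lift: "A \<in> carrier SL2R \<Longrightarrow> covers (lift A) A"
  by (auto simp: covers_def lift_apply SL2R_def)

lemma covers_comp:
  assumes "covers h A" "covers h' B" "h \<in> Bij UHPxR" "h' \<in> Bij UHPxR"
  shows "covers (compose UHPxR h h') (A ** B)"
  unfolding covers_def
proof (intro conjI ballI allI)
  fix z t assume z: "z \<in> UHP"
  obtain w s where ws: "h' (z, t) = (w, s)" by fastforce
  have "h' (z, t) \<in> UHPxR"
    using Bij_imp_funcset[OF assms(4)] z by (auto simp: Pi_def)
  moreover have "fst (h' (z, t)) = moebius_map B z"
    using assms z by (auto simp: covers_def)
  ultimately have "w \<in> UHP" "w = moebius_map B z"
    using ws by auto
  then show "fst (compose UHPxR h h' (z, t)) = moebius_map (A ** B) z"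
    using z ws assms by (simp add: compose_def covers_def moebius_comp)
qed (use assms in \<open>auto simp: covers_def det_mul\<close>)

lemma ex_covers:
  assumes "h \<in> carrier Gt" shows "\<exists>A. covers h A"
proof -
  interpret B: group "BijGroup UHPxR" by (rule group_BijGroup)
  interpret S: group SL2R by (rule group_SL2R)
  have "h \<in> generate (BijGroup UHPxR) (carrier (BijGroup UHPxR) \<inter> lift ` carrier SL2R)"
    using assms by (simp add: Gt_def carrier_subgroup_generated)
  then show ?thesis
  proof (induction rule: generate.induct)
    case one
    show ?case by (rule exI[of _ "mat 1"]) (auto simp: covers_def BijGroup_def)
  next
    case (incl h)
    then show ?case using covers_lift by blast
  next
    case (inv h)
    then obtain A where A: "A \<in> carrier SL2R" "h = lift A" by blast
    let ?B = "inv\<^bsub>SL2R\<^esub> A" and ?h = "inv\<^bsub>BijGroup UHPxR\<^esub> h"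
    have B: "?B \<in> carrier SL2R" "?B ** A = mat 1"
      using S.inv_closed[of A] S.l_inv[of A] A by (auto simp: SL2R_def)
    have c: "carrier (BijGroup UHPxR) = Bij UHPxR" "\<one>\<^bsub>BijGroup UHPxR\<^esub> = (\<lambda>p\<in>UHPxR. p)"
      "\<And>h h'. h \<in> Bij UHPxR \<Longrightarrow> h' \<in> Bij UHPxR \<Longrightarrow> h \<otimes>\<^bsub>BijGroup UHPxR\<^esub> h' = compose UHPxR h h'"
      by (simp_all add: BijGroup_def)
    have hB: "h \<in> Bij UHPxR" using lift_Bij[OF A(1)] A(2) by simp
    have hi: "?h \<in> Bij UHPxR" using B.inv_closed[of h] hB unfolding c by simp
    have "compose UHPxR h ?h = (\<lambda>p\<in>UHPxR. p)"
      using B.r_inv[of h] hB hi unfolding c by (simp only: c)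
    note h = hi hB this
    have "covers ?h ?B"
      unfolding covers_def
    proof (intro conjI ballI allI)
      fix z t assume z: "z \<in> UHP"
      obtain w s where ws: "?h (z, t) = (w, s)" by fastforce
      have w: "w \<in> UHP"
        using z ws funcset_mem[OF Bij_imp_funcset[OF h(1)], of "(z, t)"] by simp
      have "lift A (w, s) = (z, t)"
        using fun_cong[OF h(3), of "(z, t)"] z ws A by (simp add: compose_def)
      then have "moebius_map A w = z" using w by (simp add: lift_apply)
      then have "moebius_map ?B z = moebius_map (?B ** A) w"
        using w A B(1) by (subst moebius_comp) (auto simp: SL2R_def)
      then show "fst (?h (z, t)) = moebius_map ?B z" using ws B by simp
    qed (use B in \<open>simp add: SL2R_def\<close>)
    then show ?case by blast
  next
    case (eng h1 h2)
    then obtain A B where AB: "covers h1 A" "covers h2 B" by blast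
    have "h1 \<in> Bij UHPxR" "h2 \<in> Bij UHPxR"
      using eng.hyps Gt_Bij unfolding Gt_def carrier_subgroup_generated by blast+
    moreover from this have "h1 \<otimes>\<^bsub>BijGroup UHPxR\<^esub> h2 = compose UHPxR h1 h2"
      by (simp add: BijGroup_def)
    ultimately show ?case using covers_comp[OF AB] by metis
  qed
qed

lemma covers_unique:
  assumes "covers h A" "covers h B" shows "psl A = psl B"
  using assms unfolding covers_def by (intro moebius_inj) auto

lemma hom_unique:
  assumes "\<phi> \<in> hom Gt PSL2R" "\<psi> \<in> hom Gt PSL2R"
    and "\<And>A. A \<in> carrier SL2R \<Longrightarrow> \<phi> (lift A) = \<psi> (lift A)" and "h \<in> carrier Gt"
  shows "\<phi> h = \<psi> h"
proof -
  interpret B: group "BijGroup UHPxR" by (rule group_BijGroup)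
  interpret G: group Gt by (rule group_Gt)
  interpret P: group PSL2R by (rule group_PSL2R)
  interpret f: group_hom Gt PSL2R \<phi> using assms by unfold_locales
  interpret g: group_hom Gt PSL2R \<psi> using assms by unfold_locales
  have "h \<in> generate (BijGroup UHPxR) (carrier (BijGroup UHPxR) \<inter> lift ` carrier SL2R)"
    using assms by (simp add: Gt_def carrier_subgroup_generated)
  then have "h \<in> carrier Gt \<and> \<phi> h = \<psi> h"
  proof (induction rule: generate.induct)
    case one
    have "\<one>\<^bsub>BijGroup UHPxR\<^esub> = \<one>\<^bsub>Gt\<^esub>" by (simp add: Gt_def)
    then show ?case by simp
  next
    case (incl h)
    then show ?case using assms(3) lift_in_Gt by auto
  next
    case (inv h)
    then have h: "h \<in> carrier Gt" "\<phi> h = \<psi> h" using assms(3) lift_in_Gt by auto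
    then have "inv\<^bsub>BijGroup UHPxR\<^esub> h = inv\<^bsub>Gt\<^esub> h"
      unfolding Gt_def by (simp add: B.inv_subgroup_generated)
    then show ?case using h by simp
  next
    case (eng h1 h2)
    moreover have "h1 \<otimes>\<^bsub>BijGroup UHPxR\<^esub> h2 = h1 \<otimes>\<^bsub>Gt\<^esub> h2" by (simp add: Gt_def)
    ultimately show ?case by simp
  qed
  then show ?thesis ..
qed

lemma ex1_pr:
  "\<exists>!\<phi>. \<phi> \<in> extensional (carrier Gt) \<and> \<phi> \<in> hom Gt PSL2R \<and> (\<forall>A\<in>carrier SL2R. \<phi> (lift A) = psl A)"
proof (rule ex_ex1I)
  define \<phi> where "\<phi> = (\<lambda>h\<in>carrier Gt. psl (SOME A. covers h A))"
  have phi: "\<phi> h = psl A" if "h \<in> carrier Gt" "covers h A" for h A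
    using that(1) covers_unique[OF someI[of "covers h", OF that(2)] that(2)]
    by (simp only: \<phi>_def restrict_apply' if_True)
  have "\<phi> \<in> hom Gt PSL2R"
  proof (rule homI)
    fix h assume "h \<in> carrier Gt"
    then show "\<phi> h \<in> carrier PSL2R"
      using ex_covers[of h] phi[of h] by (auto simp: covers_def carrier_PSL2R SL2R_def)
  next
    fix h h' assume h: "h \<in> carrier Gt" "h' \<in> carrier Gt"
    then obtain A B where AB: "covers h A" "covers h' B" using ex_covers by blast
    have "covers (h \<otimes>\<^bsub>Gt\<^esub> h') (A ** B)"
      using covers_comp[OF AB] h Gt_Bij by (auto simp: Gt_mult)
    moreover have "h \<otimes>\<^bsub>Gt\<^esub> h' \<in> carrier Gt"
      using h group_Gt by (simp add: group.is_monoid monoid.m_closed)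
    ultimately show "\<phi> (h \<otimes>\<^bsub>Gt\<^esub> h') = \<phi> h \<otimes>\<^bsub>PSL2R\<^esub> \<phi> h'"
      using phi[OF h(1) AB(1)] phi[OF h(2) AB(2)] phi[of "h \<otimes>\<^bsub>Gt\<^esub> h'" "A ** B"] AB
        psl_mult[of A B] by (simp add: covers_def SL2R_def)
  qed
  moreover have "\<forall>A\<in>carrier SL2R. \<phi> (lift A) = psl A"
    using phi covers_lift lift_in_Gt by blast
  moreover have "\<phi> \<in> extensional (carrier Gt)"
    unfolding \<phi>_def by (rule restrict_extensional)
  ultimately show "\<exists>\<phi>. \<phi> \<in> extensional (carrier Gt) \<and> \<phi> \<in> hom Gt PSL2R \<and> (\<forall>A\<in>carrier SL2R. \<phi> (lift A) = psl A)"
    by blast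
next
  fix \<phi> \<psi>
  assume 1: "\<phi> \<in> extensional (carrier Gt) \<and> \<phi> \<in> hom Gt PSL2R \<and> (\<forall>A\<in>carrier SL2R. \<phi> (lift A) = psl A)"
    and 2: "\<psi> \<in> extensional (carrier Gt) \<and> \<psi> \<in> hom Gt PSL2R \<and> (\<forall>A\<in>carrier SL2R. \<psi> (lift A) = psl A)"
  show "\<phi> = \<psi>"
  proof (rule extensionalityI[of _ "carrier Gt"])
    fix h assume "h \<in> carrier Gt"
    then show "\<phi> h = \<psi> h"
      using hom_unique[of \<phi> \<psi> h] 1 2 by metis
  qed (use 1 2 in blast)+
qed


lemma pr_extensional: "pr \<in> extensional (carrier Gt)"
  and pr_hom: "pr \<in> hom Gt PSL2R"
  and pr_lift: "A \<in> carrier SL2R \<Longrightarrow> pr (lift A) = psl A"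
  using theI'[OF ex1_pr] unfolding pr_def[symmetric] by blast+

lemma lift_minus_mat1: "lift (- mat 1) = (\<lambda>(z, t)\<in>UHPxR. (z, t - pi))"
proof -
  have "aut_factor (- mat 1) z = -1" for z
    by (simp add: aut_factor_def mat_def)
  moreover have "moebius_map (- mat 1) z = z" for z
    by (simp only: moebius_minus moebius_mat1)
  moreover have "Arg (- 1) = pi" using Arg_minus[of 1] by simp
  ultimately show ?thesis by (simp only: lift_def)
qed

lemma zeta_in_Gt: "zeta \<in> carrier Gt"
proof -
  interpret G: group Gt by (rule group_Gt)
  have m1: "lift (- mat 1) \<in> carrier Gt"
    by (rule lift_in_Gt) (simp add: SL2R_def det_minus)
  let ?h = "inv\<^bsub>Gt\<^esub> (lift (- mat 1))"
  have h: "?h \<in> carrier Gt" using m1 by (rule G.inv_closed)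
  have hB: "?h \<in> Bij UHPxR" using h Gt_Bij by blast
  have "\<one>\<^bsub>Gt\<^esub> = (\<lambda>p\<in>UHPxR. p)" by (simp add: Gt_def BijGroup_def)
  then have c: "compose UHPxR ?h (lift (- mat 1)) = (\<lambda>p\<in>UHPxR. p)"
    using G.l_inv[OF m1] Gt_mult[OF h m1] by simp
  have "?h = zeta"
  proof (rule extensionalityI)
    fix p assume p: "p \<in> UHPxR"
    obtain z t where zt: "p = (z, t)" by fastforce
    show "?h p = zeta p"
      using fun_cong[OF c, of "(z, t + pi)"] p unfolding zt
      by (simp add: compose_def lift_minus_mat1 zeta_def)
  qed (use hB in \<open>auto simp: Bij_def zeta_def\<close>)
  with h show ?thesis by simp
qed

lemma zeta_in_Zt: "zeta \<in> Zt"
proof -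
  interpret B: group "BijGroup UHPxR" by (rule group_BijGroup)
  have Z: "zeta \<in> Bij UHPxR" using zeta_in_Gt Gt_Bij by blast
  then have ZB: "zeta \<in> carrier (BijGroup UHPxR)" by (simp add: BijGroup_def)
  have "zeta \<otimes>\<^bsub>BijGroup UHPxR\<^esub> h = h \<otimes>\<^bsub>BijGroup UHPxR\<^esub> zeta" if "h \<in> carrier Gt" for h
  proof -
    let ?C = "{h \<in> carrier (BijGroup UHPxR). zeta \<otimes>\<^bsub>BijGroup UHPxR\<^esub> h = h \<otimes>\<^bsub>BijGroup UHPxR\<^esub> zeta}"
    have "subgroup ?C (BijGroup UHPxR)"
    proof (rule B.subgroupI)
      have "\<one>\<^bsub>BijGroup UHPxR\<^esub> \<in> ?C" using ZB by simp
      then show "?C \<noteq> {}" by blast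
    next
      fix h assume "h \<in> ?C"
      then have h: "h \<in> carrier (BijGroup UHPxR)" "h \<otimes>\<^bsub>BijGroup UHPxR\<^esub> zeta = zeta \<otimes>\<^bsub>BijGroup UHPxR\<^esub> h"
        by auto
      have "h \<otimes>\<^bsub>BijGroup UHPxR\<^esub> (zeta \<otimes>\<^bsub>BijGroup UHPxR\<^esub> inv\<^bsub>BijGroup UHPxR\<^esub> h) = zeta \<otimes>\<^bsub>BijGroup UHPxR\<^esub> h \<otimes>\<^bsub>BijGroup UHPxR\<^esub> inv\<^bsub>BijGroup UHPxR\<^esub> h"
        using h ZB B.m_assoc[of h zeta "inv\<^bsub>BijGroup UHPxR\<^esub> h"] by simp
      also have "\<dots> = zeta"
        using h(1) ZB by (simp add: B.m_assoc)
      finally have "zeta \<otimes>\<^bsub>BijGroup UHPxR\<^esub> inv\<^bsub>BijGroup UHPxR\<^esub> h = inv\<^bsub>BijGroup UHPxR\<^esub> h \<otimes>\<^bsub>BijGroup UHPxR\<^esub> zeta"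
        using h(1) ZB by (subst B.inv_solve_left) simp_all
      then show "inv\<^bsub>BijGroup UHPxR\<^esub> h \<in> ?C" using h(1) by simp
    next
      fix h h' assume "h \<in> ?C" "h' \<in> ?C"
      then show "h \<otimes>\<^bsub>BijGroup UHPxR\<^esub> h' \<in> ?C"
        using ZB B.m_assoc[of zeta h h'] B.m_assoc[of h zeta h'] B.m_assoc[of h h' zeta] by simp
    qed blast
    moreover have "carrier (BijGroup UHPxR) \<inter> lift ` carrier SL2R \<subseteq> ?C"
    proof safe
      fix A assume A: "A \<in> carrier SL2R"
      have "compose UHPxR zeta (lift A) p = compose UHPxR (lift A) zeta p" for p
      proof (cases "p \<in> UHPxR")
        case True
        obtain z t where "p = (z, t)" by fastforce
        with True A show ?thesis
          by (simp add: compose_def zeta_def lift_apply SL2R_def moebius_UHP)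
      qed (simp add: compose_def)
      then show "zeta \<otimes>\<^bsub>BijGroup UHPxR\<^esub> lift A = lift A \<otimes>\<^bsub>BijGroup UHPxR\<^esub> zeta"
        using Z lift_Bij[OF A] by (simp add: BijGroup_def fun_eq_iff)
    qed
    ultimately have "carrier Gt \<subseteq> ?C"
      unfolding Gt_def carrier_subgroup_generated by (rule B.generate_subgroup_incl[rotated])
    with that show ?thesis by blast
  qed
  then show ?thesis
    using zeta_in_Gt by (simp add: Zt_def Gt_def)
qed

end

theory Submission
  imports Defs
begin

text \<open>The proof separates the angle \<open>\<theta>\<close> from the point \<open>z\<close>.

On a fibre \<open>{z} \<times> \<real>\<close>, a function killed by a power of \<open>W - ik\<close> is \<open>e\<^sup>i\<^sup>k\<^sup>\<theta>\<close> times a polynomial in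
\<open>\<theta>\<close>. The centre contains the shift by \<open>\<pi>\<close>, so invariance makes this function \<open>\<pi>\<close>-periodic in \<open>\<theta>\<close>.
Periodicity rules out a non-constant polynomial and, unless the function vanishes on the fibre,
forces \<open>e\<^sup>i\<^sup>k\<^sup>\<pi> = 1\<close>, that is, \<open>k\<close> is an even integer. This is \<open>centre_invariant_eigenfunction\<close>; it gives
the first half of the theorem, and it also shows that every element of \<open>Etilde\<close> has the form
\<open>y\<^sup>n F(z) e\<^sup>2\<^sup>i\<^sup>n\<^sup>\<theta>\<close> when \<open>k = 2n\<close>, since the full preimage of \<open>\<Gamma>\<close> contains the same shift.

For the second half, write \<open>weight_lift n F\<close> for the function \<open>y\<^sup>n F(z) e\<^sup>2\<^sup>i\<^sup>n\<^sup>\<theta>\<close>. Each condition defining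
\<open>Etilde\<close> for the lift is equivalent to the matching condition on \<open>F\<close>.

\<^item> Eigenvalue equation: differentiating the factor \<open>y\<^sup>n e\<^sup>2\<^sup>i\<^sup>n\<^sup>\<theta>\<close> turns the Casimir operator into the
  operator \<open>L_op (2 * n)\<close> on \<open>F\<close> (\<open>casimir_weight_lift\<close>).
\<^item> Invariance: every element of the covering group acts by \<open>(z, \<theta>) \<mapsto> (Az, \<theta> - s)\<close>, where
  \<open>A\<close> is a matrix representing its projection and \<open>s\<close> is some argument of \<open>cz + d\<close> (\<open>Gt_element_action\<close>). As
  \<open>Im (Az) = y / |cz + d|\<^sup>2\<close>, translating the lift multiplies \<open>F(Az)\<close> by exactly \<open>(cz + d)\<^sup>-\<^sup>2\<^sup>n\<close>, so
  translation of lifts is the slash action on \<open>F\<close> (\<open>weight_lift_translate\<close>).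
\<^item> Growth: the two functions differ in absolute value by the factor \<open>Im (Az)\<^sup>n\<close>. Near the cusp
  both \<open>Im (Az)\<close> and its inverse are at most a multiple of \<open>y\<close>, so the factor is absorbed by
  replacing the exponent \<open>a\<close> by \<open>a + 1\<close> (\<open>height_power_bound\<close>).\<close>

section \<open>Calculus of smooth functions\<close>

lemma has_derivative_cong_open:
  assumes "open S" "x \<in> S" "\<And>y. y \<in> S \<Longrightarrow> f y = g y"
  shows "(f has_derivative D) (at x) \<longleftrightarrow> (g has_derivative D) (at x)"
  using has_derivative_transform_within_open[of f D x UNIV S g]
    has_derivative_transform_within_open[of g D x UNIV S f] assms by auto

lemma dir_deriv_cong:
  assumes "open S" "x \<in> S" "\<And>y. y \<in> S \<Longrightarrow> f y = g y"
  shows "dir_deriv v f x = dir_deriv v g x"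
  using has_derivative_cong_open[OF assms] by (simp add: dir_deriv_def frechet_derivative_def)

lemma Ck_on_cong:
  assumes "open S" "\<And>x. x \<in> S \<Longrightarrow> f x = g x"
  shows "Ck_on n S f \<longleftrightarrow> Ck_on n S g"
  using assms(2)
proof (induction n arbitrary: f g)
  case 0
  then show ?case by (auto cong: continuous_on_cong)
next
  case (Suc n)
  have "Ck_on n S (dir_deriv v f) \<longleftrightarrow> Ck_on n S (dir_deriv v g)" for v
    by (rule Suc.IH, rule dir_deriv_cong[OF assms(1)]) (simp_all add: Suc.prems)
  moreover have "f differentiable (at x) \<longleftrightarrow> g differentiable (at x)" if "x \<in> S" for x
    using has_derivative_cong_open[OF assms(1) that, of f g] Suc.prems by (simp add: differentiable_def)
  ultimately show ?case by simp
qed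

lemma dir_deriv_eq: "(f has_derivative D) (at x) \<Longrightarrow> dir_deriv v f x = D v"
  by (simp add: dir_deriv_def frechet_derivative_at[symmetric])

lemma has_derivative_dir_deriv:
  "f differentiable (at x) \<Longrightarrow> (f has_derivative (\<lambda>v. dir_deriv v f x)) (at x)"
  by (simp add: dir_deriv_def frechet_derivative_works[symmetric])

lemma dir_deriv_add:
  assumes "f differentiable (at x)" "g differentiable (at x)"
  shows "dir_deriv v (\<lambda>y. f y + g y) x = dir_deriv v f x + dir_deriv v g x"
  by (rule dir_deriv_eq[OF has_derivative_add[OF assms[THEN has_derivative_dir_deriv]]])

lemma dir_deriv_mult:
  fixes f g :: "'a::real_normed_vector \<Rightarrow> 'b::real_normed_algebra"
  assumes "f differentiable (at x)" "g differentiable (at x)"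
  shows "dir_deriv v (\<lambda>y. f y * g y) x = f x * dir_deriv v g x + dir_deriv v f x * g x"
  by (rule dir_deriv_eq[OF has_derivative_mult[OF assms[THEN has_derivative_dir_deriv]]])

lemma dir_deriv_linear_compose:
  assumes "bounded_linear L" "f differentiable (at (L x))"
  shows "(\<lambda>y. f (L y)) differentiable (at x)" "dir_deriv v (\<lambda>y. f (L y)) x = dir_deriv (L v) f (L x)"
proof -
  have "((\<lambda>y. f (L y)) has_derivative (\<lambda>v. dir_deriv (L v) f (L x))) (at x)"
    using has_derivative_compose[OF bounded_linear.has_derivative[OF assms(1) has_derivative_ident]
        has_derivative_dir_deriv[OF assms(2)]] by simp
  then show "(\<lambda>y. f (L y)) differentiable (at x)"
    "dir_deriv v (\<lambda>y. f (L y)) x = dir_deriv (L v) f (L x)"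
    by (auto simp: differentiable_def dir_deriv_eq)
qed

lemma Ck_on_Suc_imp: "Ck_on (Suc n) S f \<Longrightarrow> Ck_on n S f"
proof (induction n arbitrary: f)
  case 0
  then show ?case
    by (simp add: continuous_at_imp_continuous_on differentiable_imp_continuous_within)
qed auto

lemma Ck_on_add:
  assumes "open S" "Ck_on n S f" "Ck_on n S g"
  shows "Ck_on n S (\<lambda>x. f x + g x)"
  using assms(2,3)
proof (induction n arbitrary: f g)
  case (Suc n)
  have "Ck_on n S (dir_deriv v (\<lambda>x. f x + g x))" for v
    using Suc by (subst Ck_on_cong[OF assms(1) dir_deriv_add]) auto
  then show ?case using Suc.prems by simp
qed (auto intro: continuous_on_add)

lemma Ck_on_mult:
  fixes f g :: "'a::real_normed_vector \<Rightarrow> 'b::real_normed_algebra"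
  assumes "open S" "Ck_on n S f" "Ck_on n S g"
  shows "Ck_on n S (\<lambda>x. f x * g x)"
  using assms(2,3)
proof (induction n arbitrary: f g)
  case (Suc n)
  have "Ck_on n S (dir_deriv v (\<lambda>x. f x * g x))" for v
  proof (subst Ck_on_cong[OF assms(1) dir_deriv_mult])
    show "Ck_on n S (\<lambda>x. f x * dir_deriv v g x + dir_deriv v f x * g x)"
      using Suc.prems Suc.prems[THEN Ck_on_Suc_imp]
      by (intro Ck_on_add assms Suc.IH) simp_all
  qed (use Suc.prems in auto)
  then show ?case using Suc.prems by simp
qed (auto intro: continuous_on_mult)

text \<open>Only linear changes of variables occur below: the projection \<open>(z, \<theta>) \<mapsto> z\<close> and the section
\<open>z \<mapsto> (z, 0)\<close>. For these the directional derivative of the composition is again a composition with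
the same map, so the induction needs no product rule.\<close>

lemma Ck_on_linear_compose:
  assumes "open S" "bounded_linear L" "L ` S \<subseteq> T" "Ck_on n T f"
  shows "Ck_on n S (\<lambda>x. f (L x))"
  using assms(4)
proof (induction n arbitrary: f)
  case 0
  then show ?case
    using continuous_on_compose2[OF _ linear_continuous_on[OF assms(2)] assms(3)] by simp
next
  case (Suc n)
  have d: "f differentiable (at (L x))" if "x \<in> S" for x
    using Suc.prems assms(3) that by auto
  have "Ck_on n S (dir_deriv v (\<lambda>x. f (L x)))" for v
    using Suc by (subst Ck_on_cong[OF assms(1) dir_deriv_linear_compose(2)[OF assms(2) d]]) auto
  then show ?case using dir_deriv_linear_compose(1)[OF assms(2) d] by simp
qed

lemma Ck_on_const: "Ck_on n S (\<lambda>x. c)"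
proof (induction n arbitrary: c)
  case (Suc n)
  have "dir_deriv v (\<lambda>x. c) = (\<lambda>x. 0)" for v :: 'a
    by (rule ext) (rule dir_deriv_eq, rule has_derivative_const)
  then show ?case using Suc by simp
qed simp

lemma Ck_on_linear:
  assumes "bounded_linear L" shows "Ck_on n S L"
proof (cases n)
  case 0
  then show ?thesis using assms by (simp add: linear_continuous_on)
next
  case (Suc m)
  have "dir_deriv v L = (\<lambda>x. L v)" for v
    by (rule ext) (rule dir_deriv_eq, rule bounded_linear_imp_has_derivative[OF assms])
  then show ?thesis
    using Suc assms by (simp add: Ck_on_const bounded_linear_imp_differentiable)
qed

text \<open>The derivative of \<open>1/f\<close> is a product of \<open>f'\<close> with two copies of \<open>1/f\<close>, which are \<open>C\<^sup>n\<close> by the induction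
hypothesis. So the order of smoothness rises by one in each step.\<close>

lemma Ck_on_inverse:
  fixes f :: "'a::real_normed_vector \<Rightarrow> 'b::real_normed_field"
  assumes "open S" "Ck_on n S f" "\<And>x. x \<in> S \<Longrightarrow> f x \<noteq> 0"
  shows "Ck_on n S (\<lambda>x. inverse (f x))"
  using assms(2)
proof (induction n)
  case 0
  then show ?case using assms(3) by (auto intro: continuous_on_inverse)
next
  case (Suc n)
  have D: "((\<lambda>x. inverse (f x)) has_derivative
      (\<lambda>v. - (inverse (f x) * dir_deriv v f x * inverse (f x)))) (at x)" if "x \<in> S" for x
    using Suc.prems that assms(3) by (intro Deriv.has_derivative_inverse has_derivative_dir_deriv) auto
  have "Ck_on n S (dir_deriv v (\<lambda>x. inverse (f x)))" for v
  proof (subst Ck_on_cong[OF assms(1) dir_deriv_eq[OF D]])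
    have "Ck_on n S (\<lambda>x. (- 1) * (inverse (f x) * dir_deriv v f x * inverse (f x)))"
      using Suc.prems Suc.IH[OF Ck_on_Suc_imp]
      by (intro Ck_on_mult Ck_on_const assms) simp_all
    then show "Ck_on n S (\<lambda>x. - (inverse (f x) * dir_deriv v f x * inverse (f x)))" by simp
  qed auto
  then show ?case using D by (auto simp: differentiable_def)
qed

lemma Ck_on_power:
  fixes f :: "'a::real_normed_vector \<Rightarrow> 'b::real_normed_field"
  assumes "open S" "Ck_on n S f"
  shows "Ck_on n S (\<lambda>x. f x ^ j)"
  by (induction j) (auto intro: Ck_on_const Ck_on_mult assms)

lemma Ck_on_power_int:
  fixes f :: "'a::real_normed_vector \<Rightarrow> 'b::real_normed_field"
  assumes "open S" "Ck_on n S f" "\<And>x. x \<in> S \<Longrightarrow> f x \<noteq> 0"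
  shows "Ck_on n S (\<lambda>x. f x powi j)"
  using Ck_on_power[OF assms(1) Ck_on_inverse[OF assms], of "nat (- j)"] Ck_on_power[OF assms(1,2), of "nat j"]
  by (cases "j \<ge> 0") (simp_all add: power_int_def)

lemma has_derivative_exp_linear:
  fixes L :: "'a::real_normed_vector \<Rightarrow> complex"
  assumes "bounded_linear L"
  shows "((\<lambda>x. exp (L x)) has_derivative (\<lambda>v. exp (L x) * L v)) (at x)"
  using has_derivative_compose[OF bounded_linear_imp_has_derivative[OF assms]
      DERIV_exp[THEN has_field_derivative_imp_has_derivative]] .

lemma Ck_on_exp_linear:
  fixes L :: "'a::real_normed_vector \<Rightarrow> complex"
  assumes "open S" "bounded_linear L"
  shows "Ck_on n S (\<lambda>x. exp (L x))"
proof (induction n)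
  case 0
  then show ?case by (simp add: continuous_on_exp linear_continuous_on assms)
next
  case (Suc n)
  note D = has_derivative_exp_linear[OF assms(2)]
  have "dir_deriv v (\<lambda>x. exp (L x)) = (\<lambda>x. exp (L x) * L v)" for v
    by (rule ext) (rule dir_deriv_eq, rule D)
  moreover have "(\<lambda>x. exp (L x)) differentiable (at x)" for x
    using D by (auto simp: differentiable_def)
  ultimately show ?case using Ck_on_mult[OF assms(1) Suc Ck_on_const] by simp
qed

lemma smooth_on_diff_scaled:
  fixes f g :: "'a::real_normed_vector \<Rightarrow> 'b::real_normed_algebra_1"
  assumes "open S" "smooth_on S f" "smooth_on S g"
  shows "smooth_on S (\<lambda>x. f x - c * g x)"
proof -
  have "Ck_on n S (\<lambda>x. f x + (- c) * g x)" for n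
    using assms by (intro Ck_on_add Ck_on_mult Ck_on_const) (auto simp: smooth_on_def)
  then show ?thesis by (simp add: smooth_on_def)
qed

lemma open_UHP: "open UHP"
  unfolding UHP_def by (rule open_halfspace_Im_gt)

lemma open_UHPxR: "open UHPxR"
  unfolding UHPxR_def by (intro open_Times open_UHP open_UNIV)

lemma smooth_on_dir_deriv: "smooth_on S f \<Longrightarrow> smooth_on S (dir_deriv v f)"
  unfolding smooth_on_def by (metis Ck_on.simps(2))

lemma smooth_on_differentiable: "smooth_on S f \<Longrightarrow> x \<in> S \<Longrightarrow> f differentiable (at x)"
  unfolding smooth_on_def by (metis Ck_on.simps(2))

section \<open>Multiplication by the weight factor and the Casimir operator\<close>

text \<open>The map of the theorem in weight \<open>k = 2n\<close>. Since \<open>k / 2\<close> is an integer, \<open>y\<^sup>k\<^sup>/\<^sup>2\<close> can be written as an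
integer power, which keeps the algebra free of complex exponents. The function is not cut down to
be extensional, so that the rules of calculus apply to it directly.\<close>

definition weight_lift :: "int \<Rightarrow> (complex \<Rightarrow> complex) \<Rightarrow> complex \<times> real \<Rightarrow> complex"
  where "weight_lift n F = (\<lambda>(z, \<theta>). of_real (Im z) powi n * F z * exp (\<i> * of_int (2 * n) * of_real \<theta>))"

lemma bounded_linear_angle: "bounded_linear (\<lambda>p::complex \<times> real. \<i> * of_int (2 * n) * complex_of_real (snd p))"
  by (intro bounded_linear_const_mult bounded_linear_compose[OF bounded_linear_of_real] bounded_linear_snd)

lemma weight_lift_split:
  "weight_lift n F = (\<lambda>p. of_real (Im (fst p)) powi n * F (fst p) * exp (\<i> * of_int (2 * n) * of_real (snd p)))"
  by (simp add: weight_lift_def split_def)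

lemma bounded_linear_height: "bounded_linear (\<lambda>z. complex_of_real (Im z))"
  by (intro bounded_linear_compose[OF bounded_linear_of_real] bounded_linear_Im)

lemma smooth_on_height_power: "smooth_on UHP (\<lambda>z. complex_of_real (Im z) powi n)"
  unfolding smooth_on_def
  using Ck_on_power_int[OF open_UHP Ck_on_linear[OF bounded_linear_height]] by (auto simp: UHP_def)

lemma smooth_on_weight_lift:
  assumes "smooth_on UHP F" shows "smooth_on UHPxR (weight_lift n F)"
  unfolding smooth_on_def weight_lift_split
proof (intro allI Ck_on_mult open_UHPxR Ck_on_exp_linear bounded_linear_angle)
  fix N
  have "fst ` UHPxR \<subseteq> UHP" by (auto simp: UHPxR_def)
  note lift = Ck_on_linear_compose[OF open_UHPxR bounded_linear_fst this]
  show "Ck_on N UHPxR (\<lambda>p. complex_of_real (Im (fst p)) powi n)"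
    using smooth_on_height_power by (intro lift) (simp add: smooth_on_def)
  show "Ck_on N UHPxR (\<lambda>p. F (fst p))"
    using assms by (intro lift) (simp add: smooth_on_def)
qed

text \<open>All first derivatives of a lift are again values of lifts: differentiating \<open>y\<^sup>n\<close> produces \<open>n / y\<close>, and
differentiating the exponential produces \<open>2in\<close>. Second derivatives are then obtained by applying
the same rule to the new function on the upper half-plane.\<close>

lemma weight_lift_has_derivative:
  assumes "F differentiable (at z)" "z \<in> UHP"
  shows "(weight_lift n F has_derivative
      (\<lambda>(v, s). weight_lift n (\<lambda>z. dir_deriv v F z + of_int n * of_real (Im v) / of_real (Im z) * F z
          + \<i> * of_int (2 * n) * of_real s * F z) (z, \<theta>))) (at (z, \<theta>))"
proof -
  have z: "complex_of_real (Im z) \<noteq> 0" using assms(2) by (simp add: UHP_def)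
  have F: "((\<lambda>p. F (fst p)) has_derivative (\<lambda>v. dir_deriv (fst v) F z)) (at (z, \<theta>))"
    using has_derivative_compose[OF has_derivative_fst[OF has_derivative_ident], of F "\<lambda>v. dir_deriv v F z" "(z, \<theta>)" UNIV]
      has_derivative_dir_deriv[OF assms(1)] by simp
  have E: "((\<lambda>p. exp (\<i> * of_int (2 * n) * of_real (snd p))) has_derivative
      (\<lambda>v. exp (\<i> * of_int (2 * n) * of_real \<theta>) * (\<i> * of_int (2 * n) * of_real (snd v)))) (at (z, \<theta>))"
    using has_derivative_exp_linear[OF bounded_linear_angle, of n "(z, \<theta>)"] by simp
  have h: "((\<lambda>p. complex_of_real (Im (fst p))) has_derivative (\<lambda>v. of_real (Im (fst v)))) (at (z, \<theta>))"
    by (intro bounded_linear_imp_has_derivative bounded_linear_compose[OF bounded_linear_height] bounded_linear_fst)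
  have P: "((\<lambda>p. complex_of_real (Im (fst p)) powi n) has_derivative
      (\<lambda>v. of_real (Im (fst v)) * (of_int n * of_real (Im z) powi (n - 1)))) (at (z, \<theta>))"
    using has_derivative_power_int[OF _ h, of n] z by simp
  show ?thesis
    unfolding weight_lift_split
    by (rule has_derivative_eq_rhs[OF has_derivative_mult[OF has_derivative_mult[OF P F] E]])
       (use z in \<open>simp add: fun_eq_iff power_int_diff field_simps\<close>)
qed

lemma
  assumes "F differentiable (at (fst p))" "p \<in> UHPxR"
  shows D_x_weight_lift: "D_x (weight_lift n F) p = weight_lift n (dir_deriv 1 F) p"
    and D_y_weight_lift: "D_y (weight_lift n F) p
      = weight_lift n (\<lambda>z. dir_deriv \<i> F z + of_int n / of_real (Im z) * F z) p"
    and D_theta_weight_lift: "D_theta (weight_lift n F) p = \<i> * of_int (2 * n) * weight_lift n F p"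
proof -
  obtain z \<theta> where p: "p = (z, \<theta>)" by fastforce
  with assms have z: "F differentiable (at z)" "z \<in> UHP" by auto
  note D = dir_deriv_eq[OF weight_lift_has_derivative[OF z], of _ n \<theta>]
  have "dir_deriv 0 F z = 0"
    using has_derivative_dir_deriv[OF z(1)] has_derivative_bounded_linear linear_simps(3) by blast
  then show "D_x (weight_lift n F) p = weight_lift n (dir_deriv 1 F) p"
    "D_y (weight_lift n F) p
      = weight_lift n (\<lambda>z. dir_deriv \<i> F z + of_int n / of_real (Im z) * F z) p"
    "D_theta (weight_lift n F) p = \<i> * of_int (2 * n) * weight_lift n F p"
    unfolding p D by (simp_all add: weight_lift_def)
qed

text \<open>With \<open>G = F\<^sub>y + (n/y) F\<close>, applying \<open>D_y\<close> twice to the lift gives the lift of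
\<open>G\<^sub>y + (n/y) G = F\<^sub>y\<^sub>y + (2n/y) F\<^sub>y + (n(n - 1)/y\<^sup>2) F\<close>, and \<open>D_x D_theta\<close> gives the lift of \<open>2in F\<^sub>x\<close>. After
multiplication by \<open>-y\<^sup>2\<close> and by \<open>y\<close>, these account for the terms of \<open>L_op (2 * n)\<close> of order one and zero.\<close>

lemma casimir_weight_lift:
  assumes F: "smooth_on UHP F" and p: "p \<in> UHPxR"
  shows "casimir (weight_lift n F) p = weight_lift n (L_op (2 * n) F) p"
proof -
  obtain z \<theta> where zp: "p = (z, \<theta>)" by fastforce
  with p have z: "z \<in> UHP" "Im z \<noteq> 0" by (auto simp: UHP_def)
  have U: "fst q \<in> UHP" if "q \<in> UHPxR" for q using that by (auto simp: UHPxR_def)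
  note d = smooth_on_differentiable[OF F] smooth_on_differentiable[OF smooth_on_dir_deriv[OF F]]
  define G where "G = (\<lambda>z. dir_deriv \<i> F z + of_int n / of_real (Im z) * F z)"
  have "((\<lambda>z. inverse (complex_of_real (Im z))) has_derivative
      (\<lambda>v. - (inverse (of_real (Im z)) * of_real (Im v) * inverse (of_real (Im z))))) (at z)"
    using z(2) by (intro Deriv.has_derivative_inverse bounded_linear_imp_has_derivative bounded_linear_height) simp
  then have "((\<lambda>z. of_int n / of_real (Im z)) has_derivative
      (\<lambda>v. - (of_int n * of_real (Im v) / (complex_of_real (Im z))\<^sup>2))) (at z)"
    unfolding divide_inverse
    by (rule has_derivative_eq_rhs[OF bounded_linear.has_derivative[OF bounded_linear_mult_right]])
       (simp add: power2_eq_square mult_ac)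
  then have "(G has_derivative (\<lambda>v. dir_deriv v (dir_deriv \<i> F) z
      + (of_int n / of_real (Im z) * dir_deriv v F z
         + - (of_int n * of_real (Im v) / (complex_of_real (Im z))\<^sup>2) * F z))) (at z)"
    unfolding G_def
    by (intro has_derivative_add has_derivative_mult has_derivative_dir_deriv d z)
  then have G: "G differentiable (at z)" "dir_deriv \<i> G z = dir_deriv \<i> (dir_deriv \<i> F) z
      + of_int n / of_real (Im z) * dir_deriv \<i> F z - of_int n / (of_real (Im z))\<^sup>2 * F z"
    by (auto simp: differentiable_def dir_deriv_eq)
  have "D_x (D_x (weight_lift n F)) p = D_x (weight_lift n (dir_deriv 1 F)) p"
    by (rule dir_deriv_cong[OF open_UHPxR p]) (simp add: D_x_weight_lift d U)
  also have "\<dots> = weight_lift n (dir_deriv 1 (dir_deriv 1 F)) p"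
    by (simp add: D_x_weight_lift d U p)
  finally have xx: "D_x (D_x (weight_lift n F)) p = weight_lift n (dir_deriv 1 (dir_deriv 1 F)) p" .
  have "D_y (D_y (weight_lift n F)) p = D_y (weight_lift n G) p"
    by (rule dir_deriv_cong[OF open_UHPxR p]) (simp add: D_y_weight_lift d U G_def)
  also have "\<dots> = weight_lift n (\<lambda>z. dir_deriv \<i> G z + of_int n / of_real (Im z) * G z) p"
    by (rule D_y_weight_lift) (use G(1) p zp in simp_all)
  finally have yy: "D_y (D_y (weight_lift n F)) p
    = weight_lift n (\<lambda>z. dir_deriv \<i> G z + of_int n / of_real (Im z) * G z) p" .
  have "D_x (D_theta (weight_lift n F)) p = D_x (\<lambda>q. (\<i> * of_int (2 * n)) * weight_lift n F q) p"
    by (rule dir_deriv_cong[OF open_UHPxR p]) (simp add: D_theta_weight_lift d U)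
  also have "\<dots> = \<i> * of_int (2 * n) * D_x (weight_lift n F) p"
    using weight_lift_has_derivative[OF d(1) z(1), of n \<theta>] z(1)
    by (subst dir_deriv_mult) (auto simp: zp dir_deriv_eq[OF has_derivative_const] differentiable_def)
  also have "\<dots> = \<i> * of_int (2 * n) * weight_lift n (dir_deriv 1 F) p"
    by (simp add: D_x_weight_lift d U p)
  finally have xt: "D_x (D_theta (weight_lift n F)) p = \<i> * of_int (2 * n) * weight_lift n (dir_deriv 1 F) p" .
  have Gz: "G z = dir_deriv \<i> F z + of_int n / of_real (Im z) * F z"
    by (simp add: G_def)
  show ?thesis
    unfolding casimir_def Let_def xx yy xt
    using z(2) by (simp add: zp weight_lift_def L_op_def Let_def G(2) Gz field_simps power2_eq_square)
qed

text \<open>The factor \<open>y\<^sup>n e\<^sup>2\<^sup>i\<^sup>n\<^sup>\<theta>\<close> has no zeros, so linear equations between lifts can be read off at the level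
of functions on the upper half-plane.\<close>

lemma weight_lift_eq_iff:
  assumes "z \<in> UHP"
  shows "weight_lift n F (z, t) = c * weight_lift n G (z, t) \<longleftrightarrow> F z = c * G z"
  using assms by (auto simp: weight_lift_def UHP_def)

lemma norm_weight_lift:
  assumes "z \<in> UHP"
  shows "norm (weight_lift n F (z, t)) = Im z powi n * norm (F z)"
proof -
  have "norm (exp (\<i> * of_int (2 * n) * of_real t)) = 1"
    using norm_exp_i_times[of "of_int (2 * n) * t"] by (simp add: mult_ac)
  then show ?thesis
    using assms by (simp add: weight_lift_def norm_mult norm_power_int UHP_def)
qed

lemma casimir_cong:
  assumes "\<And>q. q \<in> UHPxR \<Longrightarrow> f q = g q" "p \<in> UHPxR"
  shows "casimir f p = casimir g p"
proof -
  have 1: "dir_deriv v f q = dir_deriv v g q" if "q \<in> UHPxR" for v q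
    by (rule dir_deriv_cong[OF open_UHPxR that assms(1)])
  have "dir_deriv v (dir_deriv w f) p = dir_deriv v (dir_deriv w g) p" for v w
    by (rule dir_deriv_cong[OF open_UHPxR assms(2) 1])
  then show ?thesis by (simp add: casimir_def)
qed

section \<open>Periodic solutions along the fibres\<close>

lemma derivative_zero_imp_const:
  fixes \<psi> :: "real \<Rightarrow> 'a::real_normed_vector"
  assumes "\<And>t. (\<psi> has_vector_derivative 0) (at t)" shows "\<psi> t = \<psi> 0"
  using has_vector_derivative_zero_constant[of UNIV \<psi>] assms by (metis UNIV_I convex_UNIV)

text \<open>Multiplication by \<open>e\<^sup>-\<^sup>c\<^sup>t\<close> turns the operator \<open>d/dt - c\<close> into \<open>d/dt\<close>.\<close>

lemma untwist_has_vector_derivative: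
  fixes \<phi> :: "real \<Rightarrow> complex"
  assumes "(\<phi> has_vector_derivative d + c * \<phi> t) (at t)"
  shows "((\<lambda>t. exp (t *\<^sub>R (- c)) * \<phi> t) has_vector_derivative exp (t *\<^sub>R (- c)) * d) (at t)"
  using has_vector_derivative_mult[OF exp_scaleR_has_vector_derivative_right assms, of "- c"]
  by (rule has_vector_derivative_eq_rhs) (simp add: algebra_simps)

lemma twist_cancel: "exp (t *\<^sub>R (- c)) * x = y \<longleftrightarrow> x = exp (t *\<^sub>R c) * (y :: complex)"
  by (auto simp: exp_minus field_simps)

lemma solve_first_order:
  fixes \<phi> :: "real \<Rightarrow> complex"
  assumes "\<And>t. (\<phi> has_vector_derivative c * \<phi> t) (at t)"
  shows "\<phi> t = exp (t *\<^sub>R c) * \<phi> 0"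
proof -
  have "exp (t *\<^sub>R (- c)) * \<phi> t = \<phi> 0"
    using derivative_zero_imp_const[of "\<lambda>t. exp (t *\<^sub>R (- c)) * \<phi> t" t]
      untwist_has_vector_derivative[of \<phi> 0 c] assms by simp
  then show ?thesis by (simp only: twist_cancel)
qed

lemma periodic_derivative:
  assumes "\<And>t. (\<phi> has_vector_derivative \<phi>' t) (at t)" "\<And>t. \<phi> (t + T) = \<phi> t"
  shows "\<phi>' (t + T) = \<phi>' t"
proof -
  have "((\<lambda>t. t + T) has_vector_derivative 1) (at t)"
    using has_vector_derivative_add[OF has_vector_derivative_id has_vector_derivative_const] by simp
  from vector_diff_chain_at[OF this assms(1)]
  have "((\<phi> \<circ> (\<lambda>t. t + T)) has_vector_derivative 1 *\<^sub>R \<phi>' (t + T)) (at t)" .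

  moreover have "\<phi> \<circ> (\<lambda>t. t + T) = \<phi>" using assms(2) by (simp add: comp_def)
  ultimately have "(\<phi> has_vector_derivative \<phi>' (t + T)) (at t)" by simp
  then show ?thesis using assms(1) by (rule vector_derivative_unique_at)
qed

text \<open>Here \<open>(d/dt - c) \<phi> = \<psi>\<close> and \<open>(d/dt - c) \<psi> = 0\<close>, so \<open>\<phi>(t) = e\<^sup>c\<^sup>t (a + bt)\<close> with \<open>b = \<psi>(0)\<close>. Comparing
\<open>\<phi>\<close> at \<open>-T\<close>, \<open>0\<close> and \<open>T\<close> shows that a periodic function of this kind has no linear term.\<close>

lemma periodic_double_root:
  fixes \<phi> \<psi> :: "real \<Rightarrow> complex"
  assumes \<phi>: "\<And>t. (\<phi> has_vector_derivative \<psi> t + c * \<phi> t) (at t)"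
    and \<psi>: "\<And>t. (\<psi> has_vector_derivative c * \<psi> t) (at t)"
    and per: "\<And>t. \<phi> (t + T) = \<phi> t" and "T \<noteq> 0"
  shows "\<psi> t = 0"
proof -
  define b where "b = \<psi> 0"
  have b: "exp (t *\<^sub>R (- c)) * \<psi> t = b" for t
    using solve_first_order[OF \<psi>, of t] by (simp only: b_def twist_cancel)
  have "((\<lambda>t. exp (t *\<^sub>R (- c)) * \<phi> t - t *\<^sub>R b) has_vector_derivative 0) (at t)" for t
  proof -
    have "((\<lambda>t. t *\<^sub>R b) has_vector_derivative b) (at t)"
      using has_vector_derivative_scaleR[OF DERIV_ident has_vector_derivative_const[of b]] by simp
    from has_vector_derivative_diff[OF untwist_has_vector_derivative[OF \<phi>] this]
    show ?thesis by (simp only: b diff_self)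
  qed
  then have "exp (t *\<^sub>R (- c)) * \<phi> t - t *\<^sub>R b = \<phi> 0" for t
    using derivative_zero_imp_const[of "\<lambda>t. exp (t *\<^sub>R (- c)) * \<phi> t - t *\<^sub>R b" t] by simp
  then have "exp (t *\<^sub>R (- c)) * \<phi> t = \<phi> 0 + t *\<^sub>R b" for t by (simp only: diff_eq_eq)
  then have sol: "\<phi> t = exp (t *\<^sub>R c) * (\<phi> 0 + t *\<^sub>R b)" for t
    unfolding twist_cancel[symmetric] .
  define q d where "q = exp (T *\<^sub>R c)" and "d = T *\<^sub>R b"
  \<comment> \<open>The solution \<open>e\<^sup>c\<^sup>t (\<phi>(0) + bt)\<close> is compared at \<open>T\<close> and at \<open>-T\<close> with its value at \<open>0\<close>.\<close>
  have q: "q * (\<phi> 0 + d) = \<phi> 0" "\<phi> 0 - d = q * \<phi> 0"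
    using per[of 0] per[of "- T"] sol[of T] sol[of "- T"] twist_cancel[of T c "\<phi> 0 - d" "\<phi> 0"]
    by (simp_all add: q_def d_def)
  have "q * d = q * (\<phi> 0 + d) - q * \<phi> 0" by (simp add: distrib_left)
  also have "\<dots> = d" unfolding q(1) q(2)[symmetric] by simp
  finally have "q * d = d" .
  then have "d = 0 \<or> q = 1" by simp
  then have "d = 0" using q by auto
  then have "b = 0" using \<open>T \<noteq> 0\<close> by (simp add: d_def)
  then show ?thesis using solve_first_order[OF \<psi>, of t] by (simp add: b_def)
qed

text \<open>The sequence \<open>\<phi> j\<close> stands for \<open>(d/dt - c)\<^sup>j \<phi>\<close>. All its members are periodic, and the order of vanishing
can be lowered one at a time by applying \<open>periodic_double_root\<close> to two consecutive members.\<close>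

lemma periodic_generalized_eigenfunction:
  fixes \<phi> :: "nat \<Rightarrow> real \<Rightarrow> complex"
  assumes D: "\<And>j t. (\<phi> j has_vector_derivative \<phi> (Suc j) t + c * \<phi> j t) (at t)"
    and per: "\<And>t. \<phi> 0 (t + T) = \<phi> 0 t" and "T \<noteq> 0"
    and nil: "\<And>t. \<phi> n t = 0"
  shows "\<phi> 1 t = 0"
proof -
  have per: "\<phi> j (t + T) = \<phi> j t" for j t
  proof (induction j arbitrary: t)
    case (Suc j)
    show ?case using periodic_derivative[OF D Suc, of t] Suc by simp
  qed (rule per)
  have "\<phi> (Suc n) t = 0" for t
  proof -
    have "\<phi> n = (\<lambda>t. 0)" using nil by (rule ext)
    then have "(\<phi> n has_vector_derivative 0) (at t)" by simp
    with D[of n t] have "\<phi> (Suc n) t + c * \<phi> n t = 0" by (rule vector_derivative_unique_at)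
    then show ?thesis using nil by simp
  qed
  then show ?thesis
  proof (induction n arbitrary: t)
    case (Suc n)
    have "\<phi> (Suc n) t = 0" for t
    proof (rule periodic_double_root[OF D[of n] _ per \<open>T \<noteq> 0\<close>])
      show "(\<phi> (Suc n) has_vector_derivative c * \<phi> (Suc n) t) (at t)" for t
        using D[of "Suc n" t] Suc.prems by simp
    qed
    then show ?case by (rule Suc.IH)
  qed simp
qed

lemma fibre_has_vector_derivative:
  assumes "f differentiable (at (z, t))"
  shows "((\<lambda>t. f (z, t)) has_vector_derivative D_theta f (z, t)) (at t)"
proof -
  have D: "(f has_derivative (\<lambda>v. dir_deriv v f (z, t))) (at (z, t))"
    by (rule has_derivative_dir_deriv[OF assms])
  have "((\<lambda>t. (z, t)) has_derivative (\<lambda>s. (0, s))) (at t)"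
    by (intro has_derivative_Pair has_derivative_const has_derivative_ident)
  from has_derivative_compose[OF this D]
  have "((\<lambda>t. f (z, t)) has_derivative (\<lambda>s. dir_deriv (0, s) f (z, t))) (at t)" .
  moreover have "(\<lambda>s. dir_deriv (0, s) f (z, t)) = (\<lambda>s. s *\<^sub>R D_theta f (z, t))"
  proof
    fix s :: real
    have "dir_deriv (s *\<^sub>R (0, 1)) f (z, t) = s *\<^sub>R D_theta f (z, t)"
      using linear_scale[OF has_derivative_linear[OF D]] .
    moreover have "s *\<^sub>R (0, 1) = (0 :: complex, s)" by simp
    ultimately show "dir_deriv (0, s) f (z, t) = s *\<^sub>R D_theta f (z, t)" by metis
  qed
  ultimately show ?thesis by (simp only: has_vector_derivative_def)
qed

text \<open>On each fibre the nilpotency of \<open>W - ik\<close> improves to \<open>W f = ik f\<close>, so \<open>f\<close> is determined by its values at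
\<open>\<theta> = 0\<close>. If it is not zero there, then periodicity gives \<open>e\<^sup>i\<^sup>k\<^sup>\<pi> = 1\<close>.\<close>

lemma centre_invariant_eigenfunction:
  assumes f: "smooth_on UHPxR f"
    and nil: "\<forall>p\<in>UHPxR. ((\<lambda>h q. D_theta h q - \<i> * k * h q) ^^ n) f p = 0"
    and per: "\<forall>z\<in>UHP. \<forall>t. f (z, t + pi) = f (z, t)"
    and z: "z \<in> UHP"
  shows "D_theta f (z, t) = \<i> * k * f (z, t)"
    and "f (z, t) = f (z, 0) * exp (\<i> * k * of_real t)"
    and "f (z, t) \<noteq> 0 \<Longrightarrow> \<exists>l::int. even l \<and> k = of_int l"
proof -
  define D where "D = (\<lambda>h q. D_theta h q - \<i> * k * h q)"
  have smooth: "smooth_on UHPxR ((D ^^ j) f)" for j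
    by (induction j) (auto simp: D_def f intro: smooth_on_diff_scaled open_UHPxR smooth_on_dir_deriv)
  have "((D ^^ 1) f) (z, t) = 0" for t
  proof (rule periodic_generalized_eigenfunction[where \<phi> = "\<lambda>j t. (D ^^ j) f (z, t)" and T = pi and n = n and c = "\<i> * k"])
    fix j t
    have "D_theta ((D ^^ j) f) (z, t) = (D ^^ Suc j) f (z, t) + \<i> * k * (D ^^ j) f (z, t)"
      by (simp add: D_def)
    then show "((\<lambda>t. (D ^^ j) f (z, t)) has_vector_derivative
        (D ^^ Suc j) f (z, t) + \<i> * k * (D ^^ j) f (z, t)) (at t)"
      using fibre_has_vector_derivative[OF smooth_on_differentiable[OF smooth], of z t j] z by simp
  qed (use nil per z in \<open>auto simp: D_def\<close>)
  then show eig: "D_theta f (z, t) = \<i> * k * f (z, t)" for t by (simp add: D_def)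
  have sol: "f (z, t) = exp (t *\<^sub>R (\<i> * k)) * f (z, 0)" for t
  proof (rule solve_first_order)
    show "((\<lambda>t. f (z, t)) has_vector_derivative \<i> * k * f (z, t)) (at t)" for t
      using fibre_has_vector_derivative[OF smooth_on_differentiable[OF f], of z t] z eig by simp
  qed
  from sol[of t] show "f (z, t) = f (z, 0) * exp (\<i> * k * of_real t)"
    by (simp add: scaleR_conv_of_real mult_ac)
  assume "f (z, t) \<noteq> 0"
  then have "f (z, 0) \<noteq> 0" using sol[of t] by auto
  then have "exp (\<i> * k * of_real pi) = 1"
    using sol[of pi] bspec[OF per z, THEN spec, of 0] by (simp add: scaleR_conv_of_real mult_ac)
  then obtain n :: int where "Im k = 0" "Re k * pi = of_int (2 * n) * pi"
    by (auto simp: exp_eq_1)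
  then have "k = of_int (2 * n)" by (simp add: complex_eq_iff)
  then show "\<exists>l::int. even l \<and> k = of_int l" by (metis dvd_triv_left)
qed

section \<open>The action of the covering group\<close>

text \<open>Elements of the covering group are words in the generators \<open>lift A\<close> and their inverses, and each
generator shifts the angle by minus the principal argument of \<open>cz + d\<close>. Under composition the
arguments add up by the cocycle relation for \<open>aut_factor\<close>. The sum may leave the interval
\<open>(-\<pi>, \<pi>]\<close>, so all that survives is that the shift is minus some argument of \<open>cz + d\<close>. That
\<open>A\<close> represents the projection of the element is carried along in the same induction.\<close>

lemma Gt_element_action:
  assumes "h \<in> carrier Gt"
  shows "\<exists>A\<in>carrier SL2R. pr h = psl A \<and>
    (\<forall>z\<in>UHP. \<forall>t. \<exists>s. h (z, t) = (moebius_map A z, t - s) \<and>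
       aut_factor A z = of_real (cmod (aut_factor A z)) * cis s)"
proof -
  let ?P = "\<lambda>h A. A \<in> carrier SL2R \<and> pr h = psl A \<and>
    (\<forall>z\<in>UHP. \<forall>t. \<exists>s. h (z, t) = (moebius_map A z, t - s) \<and>
       aut_factor A z = of_real (cmod (aut_factor A z)) * cis s)"
  interpret B: group "BijGroup UHPxR" by (rule group_BijGroup)
  interpret S: group SL2R by (rule group_SL2R)
  interpret G: group Gt by (rule group_Gt)
  interpret P: group PSL2R by (rule group_PSL2R)
  interpret f: group_hom Gt PSL2R pr using pr_hom by unfold_locales
  have ones: "\<one>\<^bsub>Gt\<^esub> = (\<lambda>p\<in>UHPxR. p)" "\<one>\<^bsub>PSL2R\<^esub> = psl (mat 1)"
    by (simp_all add: Gt_def BijGroup_def PSL2R_def FactGroup_def psl_eq)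
  have lift_form: "?P (lift A) A" if A: "A \<in> carrier SL2R" for A
  proof (intro conjI ballI allI exI)
    fix z t assume "z \<in> UHP"
    then show "lift A (z, t) = (moebius_map A z, t - Arg (aut_factor A z))" by (rule lift_apply)
    show "aut_factor A z = of_real (cmod (aut_factor A z)) * cis (Arg (aut_factor A z))"
      using Arg_eq[of "aut_factor A z"] by (cases "aut_factor A z = 0") (auto simp: cis_conv_exp)
  qed (use A pr_lift in auto)
  have "h \<in> generate (BijGroup UHPxR) (carrier (BijGroup UHPxR) \<inter> lift ` carrier SL2R)"
    using assms by (simp add: Gt_def carrier_subgroup_generated)
  then have "h \<in> carrier Gt \<and> (\<exists>A. ?P h A)"
  proof (induction rule: generate.induct)
    case one
    have "\<one>\<^bsub>Gt\<^esub> (z, t) = (moebius_map (mat 1) z, t - 0) \<and>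
        aut_factor (mat 1) z = of_real (cmod (aut_factor (mat 1) z)) * cis 0" if "z \<in> UHP" for z t
      using that by (simp add: ones(1)) (simp add: aut_factor_def mat_def)
    moreover have "mat 1 \<in> carrier SL2R" by (simp add: SL2R_def)
    ultimately have "?P \<one>\<^bsub>Gt\<^esub> (mat 1)" using ones(2) f.hom_one by metis
    moreover have "\<one>\<^bsub>BijGroup UHPxR\<^esub> = \<one>\<^bsub>Gt\<^esub>" by (simp add: Gt_def)
    ultimately show ?case by (metis G.one_closed)
  next
    case (incl h)
    then show ?case using lift_form lift_in_Gt by blast
  next
    case (inv h)
    then obtain A where A: "A \<in> carrier SL2R" "h = lift A" by blast
    let ?B = "inv\<^bsub>SL2R\<^esub> A" and ?h = "inv\<^bsub>Gt\<^esub> h"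
    have hG: "h \<in> carrier Gt" "?h \<in> carrier Gt" using A lift_in_Gt by auto
    have eq: "inv\<^bsub>BijGroup UHPxR\<^esub> h = ?h"
      using hG(1) unfolding Gt_def by (simp add: B.inv_subgroup_generated)
    have B: "?B \<in> carrier SL2R" "A ** ?B = mat 1" "?B ** A = mat 1"
      using S.inv_closed[of A] S.r_inv[of A] S.l_inv[of A] A by (auto simp: SL2R_def)
    have det: "det A = 1" "det ?B = 1" using A B by (auto simp: SL2R_def)
    have "psl ?B \<otimes>\<^bsub>PSL2R\<^esub> psl A = \<one>\<^bsub>PSL2R\<^esub>"
      using A B ones(2) psl_mult[of ?B A] by simp
    then have "inv\<^bsub>PSL2R\<^esub> psl A = psl ?B"
      using A B by (intro P.inv_equality) (auto simp: carrier_PSL2R)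
    then have pr: "pr ?h = psl ?B"
      using hG(1) A pr_lift[of A] by simp
    have "\<exists>s. ?h (z, t) = (moebius_map ?B z, t - s) \<and>
        aut_factor ?B z = of_real (cmod (aut_factor ?B z)) * cis s" if z: "z \<in> UHP" for z t
    proof -
      obtain w u where wu: "?h (z, t) = (w, u)" by fastforce
      have "?h \<in> Bij UHPxR" using hG Gt_Bij by blast
      then have w: "w \<in> UHP"
        using z wu funcset_mem[OF Bij_imp_funcset, of ?h UHPxR "(z, t)"] by simp
      have "compose UHPxR h ?h = (\<lambda>p\<in>UHPxR. p)"
        using G.r_inv[OF hG(1)] Gt_mult[OF hG] ones(1) by simp
      from fun_cong[OF this, of "(z, t)"] have "h (w, u) = (z, t)"
        using z wu by (simp add: compose_def)
      moreover obtain s where s: "h (w, u) = (moebius_map A w, u - s)"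
          "aut_factor A w = of_real (cmod (aut_factor A w)) * cis s"
        using lift_form[OF A(1)] w A(2) by blast
      ultimately have zt: "z = moebius_map A w" "u = t + s" by auto
      have "w = moebius_map ?B z"
        using moebius_comp[of ?B A w] zt det w B by simp
      moreover have "aut_factor ?B z * aut_factor A w = 1"
        using aut_factor_comp[of ?B A w] zt det w B by (simp add: aut_factor_def mat_def)
      then have "aut_factor ?B z = inverse (aut_factor A w)"
        by (metis inverse_unique mult.commute)
      then have "aut_factor ?B z = of_real (cmod (aut_factor ?B z)) * cis (- s)"
        using s(2) by (metis cis_inverse inverse_mult_distrib norm_inverse of_real_inverse)
      ultimately show ?thesis using wu zt by (intro exI[of _ "- s"]) simp
    qed
    then have "?P ?h ?B" using B pr by blast
    then show ?case using hG unfolding eq by blast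
  next
    case (eng h h')
    then obtain A B where h: "h \<in> carrier Gt" "h' \<in> carrier Gt" and A: "?P h A" and B: "?P h' B" by blast
    have det: "det A = 1" "det B = 1" using A B by (auto simp: SL2R_def)
    have eq: "h \<otimes>\<^bsub>BijGroup UHPxR\<^esub> h' = h \<otimes>\<^bsub>Gt\<^esub> h'" by (simp add: Gt_def)
    have "\<exists>s. (h \<otimes>\<^bsub>Gt\<^esub> h') (z, t) = (moebius_map (A ** B) z, t - s) \<and>
        aut_factor (A ** B) z = of_real (cmod (aut_factor (A ** B) z)) * cis s" if z: "z \<in> UHP" for z t
    proof -
      obtain s where s: "h' (z, t) = (moebius_map B z, t - s)"
          "aut_factor B z = of_real (cmod (aut_factor B z)) * cis s"
        using B z by blast
      have w: "moebius_map B z \<in> UHP" using moebius_UHP det z by blast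
      then obtain s' where s': "h (moebius_map B z, t - s) = (moebius_map A (moebius_map B z), t - s - s')"
          "aut_factor A (moebius_map B z) = of_real (cmod (aut_factor A (moebius_map B z))) * cis s'"
        using A by blast
      have "aut_factor (A ** B) z = of_real (cmod (aut_factor (A ** B) z)) * cis (s + s')"
        unfolding aut_factor_comp[OF det z] norm_mult
        by (subst s(2), subst s'(2)) (simp add: cis_mult mult_ac add_ac)
      then show ?thesis
        using s(1) s'(1) z by (intro exI[of _ "s + s'"])
          (simp add: Gt_mult[OF h] compose_def moebius_comp[OF det z])
    qed
    moreover have "A ** B \<in> carrier SL2R" using det by (simp add: SL2R_def det_mul)
    moreover have "pr (h \<otimes>\<^bsub>Gt\<^esub> h') = psl (A ** B)"
      using A B h psl_mult[of A B] by simp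
    ultimately have "?P (h \<otimes>\<^bsub>Gt\<^esub> h') (A ** B)" by blast
    then show ?case using h unfolding eq by blast
  qed
  then show ?thesis by blast
qed

lemma psl_eq_of_mem:
  assumes "\<gamma> \<in> carrier PSL2R" "A \<in> \<gamma>"
  shows "\<gamma> = psl A" "A \<in> carrier SL2R" "det A = 1"
proof -
  obtain B where B: "B \<in> carrier SL2R" "\<gamma> = psl B" using assms(1) by (auto simp: carrier_PSL2R)
  then show "\<gamma> = psl A" "A \<in> carrier SL2R" "det A = 1"
    using assms(2) by (auto simp: psl_eq SL2R_def det_minus)
qed

lemma psl_act_eq:
  assumes "\<gamma> \<in> carrier PSL2R" "A \<in> \<gamma>"
  shows "psl_act \<gamma> z = moebius_map A z"
proof -
  have "(SOME A. A \<in> \<gamma>) \<in> \<gamma>" using assms(2) by (rule someI)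
  then have "(SOME A. A \<in> \<gamma>) = A \<or> (SOME A. A \<in> \<gamma>) = - A"
    using psl_eq_of_mem(1)[OF assms] by (auto simp: psl_eq)
  then show ?thesis unfolding psl_act_def by (auto simp only: moebius_minus)
qed

lemma lift_in_full_preimage:
  assumes "\<Gamma> \<subseteq> carrier PSL2R" "\<gamma> \<in> \<Gamma>" "A \<in> \<gamma>"
  shows "lift A \<in> full_preimage \<Gamma>"
  using psl_eq_of_mem[of \<gamma> A] assms lift_in_Gt pr_lift by (auto simp: full_preimage_def)

text \<open>The lift of \<open>-1\<close> lies above the identity and shifts the angle by \<open>-\<pi>\<close>. So it belongs to the full
preimage of every subgroup.\<close>

lemma full_preimage_invariant_periodic:
  assumes "subgroup \<Gamma> PSL2R" "f \<in> invariants V (full_preimage \<Gamma>)" "z \<in> UHP"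
  shows "f (z, t + pi) = f (z, t)"
proof -
  have "\<one>\<^bsub>PSL2R\<^esub> = {mat 1, - mat 1}" by (simp add: PSL2R_def FactGroup_def)
  then have "{mat 1, - mat 1} \<in> \<Gamma>" using subgroup.one_closed[OF assms(1)] by simp
  then have "lift (- mat 1) \<in> full_preimage \<Gamma>"
    using lift_in_full_preimage[OF subgroup.subset[OF assms(1)]] by blast
  then have "translate f (lift (- mat 1)) (z, t + pi) = f (z, t + pi)"
    using assms(2) by (simp add: invariants_def)
  then show ?thesis using assms(3) by (simp add: translate_def lift_minus_mat1)
qed

lemma centre_invariant_periodic:
  assumes "f \<in> invariants V Zt" "z \<in> UHP"
  shows "f (z, t + pi) = f (z, t)"
proof -
  have "translate f zeta (z, t) = f (z, t)"
    using assms(1) zeta_in_Zt by (simp add: invariants_def)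
  then show ?thesis using assms(2) by (simp add: translate_def zeta_def)
qed

lemma Im_moebius:
  assumes "det A = 1" "z \<in> UHP"
  shows "Im (moebius_map A z) = Im z / (cmod (aut_factor A z))\<^sup>2"
proof -
  have "Im (moebius_map A z)
      = Im ((of_real (A$1$1) * z + of_real (A$1$2)) * cnj (aut_factor A z)) / (cmod (aut_factor A z))\<^sup>2"
    unfolding moebius_map_def by (subst complex_div_cnj) simp
  also have "Im ((of_real (A$1$1) * z + of_real (A$1$2)) * cnj (aut_factor A z))
      = (A$1$1 * A$2$2 - A$1$2 * A$2$1) * Im z"
    by (simp add: aut_factor_def algebra_simps)
  finally show ?thesis using assms(1) by (simp add: det_2)
qed

text \<open>Put \<open>r = |cz + d|\<close>. The power of \<open>Im (Az) = y / r\<^sup>2\<close> contributes \<open>r\<^sup>-\<^sup>2\<^sup>n\<close> and the shift of the angle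
contributes \<open>e\<^sup>-\<^sup>2\<^sup>i\<^sup>n\<^sup>s\<close>; together these are \<open>(cz + d)\<^sup>-\<^sup>2\<^sup>n\<close>, since \<open>cz + d = r e\<^sup>i\<^sup>s\<close>. It does not matter which
argument \<open>s\<close> is taken, because \<open>2n\<close> is an integer.\<close>

lemma weight_lift_translate:
  assumes A: "det A = 1" and z: "z \<in> UHP"
    and s: "aut_factor A z = of_real (cmod (aut_factor A z)) * cis s"
  shows "weight_lift n F (moebius_map A z, t - s) = weight_lift n (slash (2 * n) F A) (z, t)"
proof -
  define r where "r = complex_of_real (cmod (aut_factor A z))"
  have r: "r \<noteq> 0" using aut_factor_nz[OF A z] by (simp add: r_def)
  have "complex_of_real (Im (moebius_map A z)) = of_real (Im z) / r\<^sup>2"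
    by (simp add: Im_moebius[OF A z] r_def)
  then have "complex_of_real (Im (moebius_map A z)) powi n = of_real (Im z) powi n / r\<^sup>2 powi n"
    by (simp only: power_int_divide_distrib)
  moreover have "r powi (- (2 * n)) = inverse (r\<^sup>2 powi n)"
    by (simp only: power_int_minus power_int_mult power_int_numeral)
  moreover have "aut_factor A z powi (- (2 * n)) = r powi (- (2 * n)) * cis s powi (- (2 * n))"
    by (subst s) (simp add: power_int_mult_distrib r_def)
  moreover have "exp (\<i> * of_int (2 * n) * of_real (t - s)) = exp (\<i> * of_int (2 * n) * of_real t) * cis s powi (- (2 * n))"
    unfolding cis_power_int by (simp add: cis_conv_exp exp_add[symmetric] algebra_simps)
  ultimately show ?thesis by (simp add: weight_lift_def slash_def divide_inverse mult_ac)
qed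

text \<open>From left to right, the elements \<open>lift A\<close> suffice; from right to left, arbitrary elements of the
full preimage have to be treated, which is what \<open>Gt_element_action\<close> is for.\<close>

lemma translate_weight_lift_iff:
  assumes \<Gamma>: "\<Gamma> \<subseteq> carrier PSL2R"
  shows "(\<forall>h\<in>full_preimage \<Gamma>. translate (restrict (weight_lift n F) UHPxR) h = restrict (weight_lift n F) UHPxR)
    \<longleftrightarrow> (\<forall>\<gamma>\<in>\<Gamma>. \<forall>A\<in>\<gamma>. \<forall>z\<in>UHP. slash (2 * n) F A z = F z)" (is "?L \<longleftrightarrow> ?R")
proof
  assume L: ?L
  show ?R
  proof (intro ballI)
    fix \<gamma> A z assume A: "\<gamma> \<in> \<Gamma>" "A \<in> \<gamma>" and z: "z \<in> UHP"
    then have det: "det A = 1" using psl_eq_of_mem(3) \<Gamma> by blast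
    define s where "s = Arg (aut_factor A z)"
    have s: "aut_factor A z = of_real (cmod (aut_factor A z)) * cis s"
      using Arg_eq[of "aut_factor A z"] aut_factor_nz[OF det z] by (simp add: s_def cis_conv_exp)
    have "translate (restrict (weight_lift n F) UHPxR) (lift A) (z, 0) = restrict (weight_lift n F) UHPxR (z, 0)"
      using L lift_in_full_preimage[OF \<Gamma> A] by simp
    then have "weight_lift n F (moebius_map A z, 0 - s) = weight_lift n F (z, 0)"
      using z moebius_UHP[OF det z] by (simp add: translate_def lift_apply s_def)
    then have "weight_lift n (slash (2 * n) F A) (z, 0) = 1 * weight_lift n F (z, 0)"
      unfolding weight_lift_translate[OF det z s] by simp
    then show "slash (2 * n) F A z = F z"
      unfolding weight_lift_eq_iff[OF z] by simp
  qed
next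
  assume R: ?R
  show ?L
  proof (intro ballI ext)
    fix h p assume h: "h \<in> full_preimage \<Gamma>"
    show "translate (restrict (weight_lift n F) UHPxR) h p = restrict (weight_lift n F) UHPxR p"
    proof (cases "p \<in> UHPxR")
      case True
      obtain z t where p: "p = (z, t)" by fastforce
      with True have z: "z \<in> UHP" by simp
      obtain A s where A: "A \<in> carrier SL2R" "pr h = psl A" "h (z, t) = (moebius_map A z, t - s)"
        "aut_factor A z = of_real (cmod (aut_factor A z)) * cis s"
        using Gt_element_action[of h] h z by (fastforce simp: full_preimage_def)
      have det: "det A = 1" using A(1) by (simp add: SL2R_def)
      have "slash (2 * n) F A z = F z"
        using R h A(2) z by (auto simp: full_preimage_def psl_eq)
      then have "weight_lift n (slash (2 * n) F A) (z, t) = weight_lift n F (z, t)"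
        by (simp add: weight_lift_def)
      then show ?thesis
        using weight_lift_translate[OF det z A(4), of n F t] z moebius_UHP[OF det z]
        by (simp add: p translate_def A(3))
    qed (simp add: translate_def)
  qed
qed

section \<open>Growth at the cusps\<close>

text \<open>On a vertical strip, \<open>|cz + d|\<^sup>2 = (cx + d)\<^sup>2 + c\<^sup>2 y\<^sup>2\<close> is at least a positive constant and at most a
multiple of \<open>y\<^sup>2\<close> when \<open>y \<ge> 1\<close>. The lower bound is \<open>c\<^sup>2\<close> or, if \<open>c = 0\<close>, it is \<open>d\<^sup>2\<close>.\<close>

lemma height_comparison:
  assumes A: "det A = 1"
  obtains K where "K > 0" "\<And>x y. \<bar>x\<bar> \<le> b \<Longrightarrow> y \<ge> 1 \<Longrightarrow> Im (moebius_map A (Complex x y)) \<le> K * y"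
    "\<And>x y. \<bar>x\<bar> \<le> b \<Longrightarrow> y \<ge> 1 \<Longrightarrow> inverse (Im (moebius_map A (Complex x y))) \<le> K * y"
proof -
  define c d where "c = A$2$1" and "d = A$2$2"
  define \<delta> where "\<delta> = (if c = 0 then d\<^sup>2 else c\<^sup>2)"
  define M where "M = (\<bar>c\<bar> * (\<bar>b\<bar> + 1) + \<bar>d\<bar>)\<^sup>2"
  have "c \<noteq> 0 \<or> d \<noteq> 0" using A by (auto simp: c_def d_def det_2)
  then have "\<delta> > 0" by (auto simp: \<delta>_def)
  have "M \<ge> 0" by (simp add: M_def)
  have q: "\<delta> \<le> (cmod (aut_factor A (Complex x y)))\<^sup>2" "(cmod (aut_factor A (Complex x y)))\<^sup>2 \<le> M * y\<^sup>2"
    if "\<bar>x\<bar> \<le> b" "y \<ge> 1" for x y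
  proof -
    have "(cmod (aut_factor A (Complex x y)))\<^sup>2 = (c * x + d)\<^sup>2 + c\<^sup>2 * y\<^sup>2"
      by (simp add: cmod_power2 aut_factor_def c_def d_def power_mult_distrib)
    moreover have "c\<^sup>2 * 1 \<le> c\<^sup>2 * y\<^sup>2"
      using that by (intro mult_left_mono one_le_power) auto
    ultimately show "\<delta> \<le> (cmod (aut_factor A (Complex x y)))\<^sup>2"
      by (auto simp: \<delta>_def intro: order_trans)
    have "cmod (aut_factor A (Complex x y)) \<le> \<bar>c\<bar> * cmod (Complex x y) + \<bar>d\<bar>"
      unfolding aut_factor_def c_def d_def
      by (rule order_trans[OF norm_triangle_ineq]) (simp add: norm_mult)
    also have "\<dots> \<le> \<bar>c\<bar> * ((\<bar>b\<bar> + 1) * y) + \<bar>d\<bar> * y"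
    proof (intro add_mono mult_left_mono)
      have "cmod (Complex x y) \<le> \<bar>x\<bar> + \<bar>y\<bar>" using cmod_le[of "Complex x y"] by simp
      also have "\<dots> \<le> (\<bar>b\<bar> + 1) * y"
      proof -
        have "\<bar>b\<bar> * 1 \<le> \<bar>b\<bar> * y" using that by (intro mult_left_mono) auto
        then show ?thesis using that by (simp add: algebra_simps)
      qed
      finally show "cmod (Complex x y) \<le> (\<bar>b\<bar> + 1) * y" .
      show "\<bar>d\<bar> \<le> \<bar>d\<bar> * y" using that mult_left_mono[of 1 y "\<bar>d\<bar>"] by simp
    qed simp
    finally have "cmod (aut_factor A (Complex x y)) \<le> (\<bar>c\<bar> * (\<bar>b\<bar> + 1) + \<bar>d\<bar>) * y"
      by (simp add: algebra_simps)
    then show "(cmod (aut_factor A (Complex x y)))\<^sup>2 \<le> M * y\<^sup>2"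
      unfolding M_def power_mult_distrib[symmetric] by (intro power_mono) auto
  qed
  show thesis
  proof (rule that[of "inverse \<delta> + M"])
    show "inverse \<delta> + M > 0" using \<open>\<delta> > 0\<close> \<open>M \<ge> 0\<close> by (simp add: add_pos_nonneg)
  next
    fix x y :: real assume xy: "\<bar>x\<bar> \<le> b" "y \<ge> 1"
    have Im: "Im (moebius_map A (Complex x y)) = y / (cmod (aut_factor A (Complex x y)))\<^sup>2"
      using xy by (simp add: Im_moebius[OF A] UHP_def)
    have "Im (moebius_map A (Complex x y)) \<le> y / \<delta>"
      unfolding Im using q(1)[OF xy] \<open>\<delta> > 0\<close> xy by (intro divide_left_mono mult_pos_pos) linarith+
    also have "\<dots> \<le> (inverse \<delta> + M) * y"
      using \<open>M \<ge> 0\<close> xy by (simp add: divide_inverse algebra_simps)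
    finally show "Im (moebius_map A (Complex x y)) \<le> (inverse \<delta> + M) * y" .
    have "inverse (Im (moebius_map A (Complex x y))) \<le> M * y\<^sup>2 / y"
      unfolding Im inverse_divide using q(2)[OF xy] xy by (intro divide_right_mono) auto
    also have "\<dots> \<le> (inverse \<delta> + M) * y"
      using \<open>\<delta> > 0\<close> xy by (simp add: power2_eq_square algebra_simps)
    finally show "inverse (Im (moebius_map A (Complex x y))) \<le> (inverse \<delta> + M) * y" .
  qed
qed

lemma power_le_exp: "y \<ge> 0 \<Longrightarrow> y ^ N \<le> fact N * exp (y::real)"
  using sum_le_suminf[OF summable_exp[of y], of "{N}"] exp_converges[of y]
  by (simp add: sums_iff field_simps scaleR_conv_of_real)

lemma height_power_growth:
  assumes A: "det A = 1" and X: "bounded X"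
  shows "\<exists>C. \<forall>x\<in>X. \<forall>y\<ge>1. Im (moebius_map A (Complex x y)) powi n \<le> C * exp y"
proof -
  obtain b where b: "\<And>x. x \<in> X \<Longrightarrow> \<bar>x\<bar> \<le> b" using X by (auto simp: bounded_iff)
  obtain K where K: "K > 0" "\<And>x y. \<bar>x\<bar> \<le> b \<Longrightarrow> y \<ge> 1 \<Longrightarrow> Im (moebius_map A (Complex x y)) \<le> K * y"
    "\<And>x y. \<bar>x\<bar> \<le> b \<Longrightarrow> y \<ge> 1 \<Longrightarrow> inverse (Im (moebius_map A (Complex x y))) \<le> K * y"
    using height_comparison[OF A] by metis
  define N where "N = nat \<bar>n\<bar>"
  have "Im (moebius_map A (Complex x y)) powi n \<le> (K ^ N * fact N) * exp y" if "x \<in> X" "y \<ge> 1" for x y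
  proof -
    let ?v = "Im (moebius_map A (Complex x y))"
    have "?v > 0" using moebius_UHP[OF A, of "Complex x y"] that by (simp add: UHP_def)
    have "?v powi n \<le> (K * y) ^ N"
      using K(2,3)[OF b[OF that(1)] that(2)] \<open>?v > 0\<close>
      by (cases "n \<ge> 0") (auto simp: power_int_def N_def intro!: power_mono)
    also have "\<dots> \<le> K ^ N * (fact N * exp y)"
      unfolding power_mult_distrib using K(1) that power_le_exp[of y N] by (intro mult_left_mono) auto
    finally show ?thesis by (simp add: mult_ac)
  qed
  then show ?thesis by blast
qed

text \<open>This is used with \<open>n\<close> and with \<open>- n\<close>, to pass between the growth conditions in both directions.\<close>

lemma height_power_bound:
  fixes u :: "complex \<Rightarrow> real"
  assumes A: "det A = 1" and X: "bounded X" and u0: "\<And>z. u z \<ge> 0"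
    and u: "\<forall>\<^sub>F y in at_top. \<forall>x\<in>X. u (Complex x y) \<le> C * exp (a * y)"
  shows "\<exists>C. \<forall>\<^sub>F y in at_top. \<forall>x\<in>X.
    Im (moebius_map A (Complex x y)) powi n * u (Complex x y) \<le> C * exp ((a + 1) * y)"
proof -
  obtain C' where C': "\<And>x y. x \<in> X \<Longrightarrow> y \<ge> 1 \<Longrightarrow> Im (moebius_map A (Complex x y)) powi n \<le> C' * exp y"
    using height_power_growth[OF A X] by metis
  have "\<forall>\<^sub>F y in at_top. \<forall>x\<in>X.
      Im (moebius_map A (Complex x y)) powi n * u (Complex x y) \<le> (C' * C) * exp ((a + 1) * y)"
    using u eventually_ge_at_top[of 1]
  proof eventually_elim
    fix y :: real assume y: "\<forall>x\<in>X. u (Complex x y) \<le> C * exp (a * y)" "1 \<le> y"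
    show "\<forall>x\<in>X. Im (moebius_map A (Complex x y)) powi n * u (Complex x y) \<le> (C' * C) * exp ((a + 1) * y)"
    proof
      fix x assume x: "x \<in> X"
      have "Im (moebius_map A (Complex x y)) > 0"
        using moebius_UHP[OF A, of "Complex x y"] y by (simp add: UHP_def)
      then have "0 \<le> Im (moebius_map A (Complex x y)) powi n" by simp
      with C'[OF x y(2)] have "0 \<le> C' * exp y" by linarith
      with C'[OF x y(2)] have "Im (moebius_map A (Complex x y)) powi n * u (Complex x y)
          \<le> (C' * exp y) * (C * exp (a * y))"
        using y(1) x u0 by (intro mult_mono) auto
      then show "Im (moebius_map A (Complex x y)) powi n * u (Complex x y) \<le> (C' * C) * exp ((a + 1) * y)"
        by (simp add: exp_add algebra_simps)
    qed
  qed
  then show ?thesis by blast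
qed

text \<open>The angle does not affect absolute values, so uniformity in \<open>\<theta>\<close> is automatic in one direction, and
the angle \<open>0\<close> is enough in the other.\<close>

lemma weight_lift_growth_iff:
  assumes g: "\<forall>\<kappa>\<in>K. g \<kappa> \<in> carrier PSL2R" and m: "\<forall>\<kappa>\<in>K. m \<kappa> \<in> g \<kappa>"
  shows "(\<exists>a::real. \<forall>X Y. compact X \<and> compact Y \<longrightarrow> (\<forall>\<kappa>\<in>K.
        \<exists>C. \<forall>\<^sub>F y in at_top. \<forall>x\<in>X. \<forall>\<theta>\<in>Y.
          norm (restrict (weight_lift n F) UHPxR (lift (m \<kappa>) (Complex x y, \<theta>))) \<le> C * exp (a * y)))
    \<longleftrightarrow> (\<exists>a::real. \<forall>\<kappa>\<in>K. \<forall>X :: real set. compact X \<longrightarrow>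
        (\<exists>C. \<forall>\<^sub>F y in at_top. \<forall>x\<in>X.
          norm (F (psl_act (g \<kappa>) (Complex x y))) \<le> C * exp (a * y)))" (is "?L \<longleftrightarrow> ?R")
proof -
  let ?f = "restrict (weight_lift n F) UHPxR"
  have det: "det (m \<kappa>) = 1" if "\<kappa> \<in> K" for \<kappa> using psl_eq_of_mem(3) g m that by blast
  have act: "psl_act (g \<kappa>) z = moebius_map (m \<kappa>) z" if "\<kappa> \<in> K" for \<kappa> z
    using psl_act_eq g m that by blast
  have norm: "norm (?f (lift (m \<kappa>) (Complex x y, t)))
      = Im (moebius_map (m \<kappa>) (Complex x y)) powi n * norm (F (moebius_map (m \<kappa>) (Complex x y)))"
    if "\<kappa> \<in> K" "y > 0" for \<kappa> x y t
  proof -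
    have "Complex x y \<in> UHP" using that by (simp add: UHP_def)
    with moebius_UHP[OF det[OF that(1)] this] show ?thesis
      by (simp add: lift_apply norm_weight_lift)
  qed
  show ?thesis
  proof
    assume ?R
    then obtain a where a: "\<And>\<kappa> X. \<kappa> \<in> K \<Longrightarrow> compact X \<Longrightarrow> \<exists>C. \<forall>\<^sub>F y in at_top. \<forall>x\<in>X.
        norm (F (psl_act (g \<kappa>) (Complex x y))) \<le> C * exp (a * y)"
      by blast
    show ?L
    proof (rule exI[of _ "a + 1"], intro allI impI ballI)
      fix X Y :: "real set" and \<kappa> assume X: "compact X \<and> compact Y" and \<kappa>: "\<kappa> \<in> K"
      then obtain C where "\<forall>\<^sub>F y in at_top. \<forall>x\<in>X. norm (F (moebius_map (m \<kappa>) (Complex x y))) \<le> C * exp (a * y)"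
        using a[OF \<kappa>, of X] unfolding act[OF \<kappa>] by blast
      from height_power_bound[OF det[OF \<kappa>] _ _ this, of n] X compact_imp_bounded
      obtain C' where C': "\<forall>\<^sub>F y in at_top. \<forall>x\<in>X. Im (moebius_map (m \<kappa>) (Complex x y)) powi n *
          norm (F (moebius_map (m \<kappa>) (Complex x y))) \<le> C' * exp ((a + 1) * y)"
        by auto
      have "\<forall>\<^sub>F y in at_top. \<forall>x\<in>X. \<forall>\<theta>\<in>Y. norm (?f (lift (m \<kappa>) (Complex x y, \<theta>))) \<le> C' * exp ((a + 1) * y)"
        using C' eventually_gt_at_top[of 0]
        by eventually_elim (simp only: norm[OF \<kappa>], blast)
      then show "\<exists>C. \<forall>\<^sub>F y in at_top. \<forall>x\<in>X. \<forall>\<theta>\<in>Y. norm (?f (lift (m \<kappa>) (Complex x y, \<theta>))) \<le> C * exp ((a + 1) * y)"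
        by blast
    qed
  next
    assume ?L
    then obtain a where a: "\<forall>X Y. compact X \<and> compact Y \<longrightarrow> (\<forall>\<kappa>\<in>K. \<exists>C. \<forall>\<^sub>F y in at_top. \<forall>x\<in>X. \<forall>\<theta>\<in>Y.
        norm (?f (lift (m \<kappa>) (Complex x y, \<theta>))) \<le> C * exp (a * y))"
      by (rule exE)
    show ?R
    proof (rule exI[of _ "a + 1"], intro allI impI ballI)
      fix X :: "real set" and \<kappa> assume X: "compact X" and \<kappa>: "\<kappa> \<in> K"
      obtain C where "\<forall>\<^sub>F y in at_top. \<forall>x\<in>X. norm (?f (lift (m \<kappa>) (Complex x y, 0))) \<le> C * exp (a * y)"
        using a[THEN spec, THEN spec, of X "{0}"] X \<kappa> by auto
      from height_power_bound[OF det[OF \<kappa>] compact_imp_bounded[OF X] _ this, of "- n"]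
      obtain C' where C': "\<forall>\<^sub>F y in at_top. \<forall>x\<in>X. Im (moebius_map (m \<kappa>) (Complex x y)) powi (- n) *
          norm (?f (lift (m \<kappa>) (Complex x y, 0))) \<le> C' * exp ((a + 1) * y)"
        by auto
      have "\<forall>\<^sub>F y in at_top. \<forall>x\<in>X. norm (F (psl_act (g \<kappa>) (Complex x y))) \<le> C' * exp ((a + 1) * y)"
        using C' eventually_gt_at_top[of 0]
      proof eventually_elim
        fix y :: real
        assume y: "\<forall>x\<in>X. Im (moebius_map (m \<kappa>) (Complex x y)) powi (- n) *
            norm (?f (lift (m \<kappa>) (Complex x y, 0))) \<le> C' * exp ((a + 1) * y)" "0 < y"
        show "\<forall>x\<in>X. norm (F (psl_act (g \<kappa>) (Complex x y))) \<le> C' * exp ((a + 1) * y)"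
        proof
          fix x assume x: "x \<in> X"
          have "Im (moebius_map (m \<kappa>) (Complex x y)) > 0"
            using moebius_UHP[OF det[OF \<kappa>], of "Complex x y"] y by (simp add: UHP_def)
          then have "Im (moebius_map (m \<kappa>) (Complex x y)) powi (- n) *
              norm (?f (lift (m \<kappa>) (Complex x y, 0))) = norm (F (psl_act (g \<kappa>) (Complex x y)))"
            unfolding norm[OF \<kappa> y(2)] act[OF \<kappa>] by (simp add: power_int_minus)
          then show "norm (F (psl_act (g \<kappa>) (Complex x y))) \<le> C' * exp ((a + 1) * y)"
            using y(1) x by metis
        qed
      qed
      then show "\<exists>C. \<forall>\<^sub>F y in at_top. \<forall>x\<in>X. norm (F (psl_act (g \<kappa>) (Complex x y))) \<le> C * exp ((a + 1) * y)"
        by blast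
    qed
  qed
qed

section \<open>The correspondence\<close>

text \<open>The conditions that define the two spaces match one by one. The nilpotency condition in \<open>Ecal\<close> holds
already with exponent one.\<close>

lemma weight_lift_in_Etilde_iff:
  assumes \<Gamma>: "\<Gamma> \<subseteq> carrier PSL2R" and g: "\<forall>\<kappa>\<in>cusps \<Gamma>. g \<kappa> \<in> carrier PSL2R"
    and m: "\<forall>\<kappa>\<in>cusps \<Gamma>. m \<kappa> \<in> g \<kappa>"
    and F: "smooth_on UHP F" "F \<in> extensional UHP"
  shows "restrict (weight_lift n F) UHPxR \<in> Etilde \<Gamma> m (of_int (2 * n)) lam \<longleftrightarrow> F \<in> maass_forms \<Gamma> g (2 * n) lam"
proof -
  let ?f = "restrict (weight_lift n F) UHPxR"
  have smooth: "smooth_on UHPxR ?f"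
    using smooth_on_weight_lift[OF F(1), of n] Ck_on_cong[OF open_UHPxR, of "weight_lift n F" ?f]
    by (simp add: smooth_on_def)
  have "D_theta ?f p = \<i> * of_int (2 * n) * ?f p" if p: "p \<in> UHPxR" for p
  proof -
    have "fst p \<in> UHP" using p by (auto simp: UHPxR_def)
    then have "D_theta (weight_lift n F) p = \<i> * of_int (2 * n) * weight_lift n F p"
      using D_theta_weight_lift[OF smooth_on_differentiable[OF F(1)] p] by blast
    moreover have "D_theta ?f p = D_theta (weight_lift n F) p"
      by (rule dir_deriv_cong[OF open_UHPxR p]) simp
    ultimately show ?thesis using p by simp
  qed
  then have nil: "\<exists>N::nat. \<forall>p\<in>UHPxR. ((\<lambda>h q. D_theta h q - \<i> * of_int (2 * n) * h q) ^^ N) ?f p = 0"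
    by (intro exI[of _ 1]) simp
  have "casimir ?f p = casimir (weight_lift n F) p" if "p \<in> UHPxR" for p
    by (rule casimir_cong[OF _ that]) simp
  then have "(\<forall>p\<in>UHPxR. casimir ?f p = lam * ?f p)
      \<longleftrightarrow> (\<forall>p\<in>UHPxR. weight_lift n (L_op (2 * n) F) p = lam * weight_lift n F p)"
    using casimir_weight_lift[OF F(1)] by simp
  also have "\<dots> \<longleftrightarrow> (\<forall>z\<in>UHP. L_op (2 * n) F z = lam * F z)"
    using weight_lift_eq_iff by (auto simp: UHPxR_def)
  finally have cas: "(\<forall>p\<in>UHPxR. casimir ?f p = lam * ?f p) \<longleftrightarrow> (\<forall>z\<in>UHP. L_op (2 * n) F z = lam * F z)" .
  have ext: "?f \<in> extensional UHPxR" by simp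
  note growth = weight_lift_growth_iff[OF g m]
  show ?thesis
    unfolding Etilde_def invariants_def Ecal_def maass_forms_def mem_Collect_eq
    by (simp only: cas growth translate_weight_lift_iff[OF \<Gamma>] smooth ext nil F simp_thms conj_ac)
qed

text \<open>The candidate for \<open>F\<close> is forced by setting \<open>\<theta> = 0\<close>, which gives \<open>F(z) = y\<^sup>-\<^sup>n f(z, 0)\<close>.\<close>

lemma Etilde_is_weight_lift:
  assumes \<Gamma>: "subgroup \<Gamma> PSL2R" and f: "f \<in> Etilde \<Gamma> m (of_int (2 * n)) lam"
  obtains F where "smooth_on UHP F" "F \<in> extensional UHP" "f = restrict (weight_lift n F) UHPxR"
proof
  define G where "G = (\<lambda>z. complex_of_real (Im z) powi (- n) * f (z, 0))"
  have fE: "f \<in> Ecal \<Gamma> m (of_int (2 * n)) lam" using f by (simp add: Etilde_def invariants_def)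
  then have ext: "f \<in> extensional UHPxR" and smooth: "smooth_on UHPxR f"
    and "\<exists>N. \<forall>p\<in>UHPxR. ((\<lambda>h q. D_theta h q - \<i> * of_int (2 * n) * h q) ^^ N) f p = 0"
    by (simp_all add: Ecal_def)
  then obtain N where "\<forall>p\<in>UHPxR. ((\<lambda>h q. D_theta h q - \<i> * of_int (2 * n) * h q) ^^ N) f p = 0"
    by blast
  moreover have "\<forall>z\<in>UHP. \<forall>t. f (z, t + pi) = f (z, t)"
    using full_preimage_invariant_periodic[OF \<Gamma> f[unfolded Etilde_def]] by blast
  ultimately have sol: "z \<in> UHP \<Longrightarrow> f (z, t) = f (z, 0) * exp (\<i> * of_int (2 * n) * of_real t)" for z t
    using centre_invariant_eigenfunction(2)[OF smooth] by blast
  have "bounded_linear (\<lambda>z::complex. (z, 0::real))"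
    by (intro bounded_linear_Pair bounded_linear_ident bounded_linear_zero)
  from Ck_on_linear_compose[OF open_UHP this, of UHPxR _ f]
  have "Ck_on N UHP (\<lambda>z. f (z, 0))" for N
    using smooth by (simp add: smooth_on_def UHPxR_def image_subset_iff)
  then have "smooth_on UHP G"
    using smooth_on_height_power[of "- n"] unfolding G_def smooth_on_def by (intro allI Ck_on_mult open_UHP) auto
  then show "smooth_on UHP (restrict G UHP)"
    using Ck_on_cong[OF open_UHP, of G "restrict G UHP"] by (simp add: smooth_on_def)
  show "restrict G UHP \<in> extensional UHP" by simp
  show "f = restrict (weight_lift n (restrict G UHP)) UHPxR"
  proof (rule extensionalityI[OF ext])
    fix p assume p: "p \<in> UHPxR"
    obtain z t where zt: "p = (z, t)" by fastforce
    with p have z: "z \<in> UHP" by simp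
    then have "complex_of_real (Im z) powi n \<noteq> 0" by (simp add: UHP_def)
    then have "weight_lift n (restrict G UHP) (z, t) = f (z, 0) * exp (\<i> * of_int (2 * n) * of_real t)"
      using z by (simp add: weight_lift_def G_def power_int_minus)
    then show "f p = restrict (weight_lift n (restrict G UHP)) UHPxR p"
      using sol[OF z, of t] z by (simp add: zt)
  qed simp
qed

theorem theorem6p4:
  fixes \<Gamma> :: "(real^2^2) set set" and k lam :: complex
    and g :: "boundary \<Rightarrow> (real^2^2) set" and m :: "boundary \<Rightarrow> real^2^2"
  assumes "cofinite_discrete_subgroup \<Gamma>"
    and "cusp_scaling \<Gamma> g"
    and "\<And>\<kappa>. \<kappa> \<in> cusps \<Gamma> \<Longrightarrow> m \<kappa> \<in> g \<kappa>"
  shows "(\<forall>f \<in> invariants (Ecal \<Gamma> m k lam) Zt. (\<exists>p\<in>UHPxR. f p \<noteq> 0) \<longrightarrow>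
            (\<exists>l::int. even l \<and> k = of_int l) \<and>
            (\<forall>p\<in>UHPxR. D_theta f p = \<i> * k * f p)) \<and>
         (\<forall>l::int. even l \<and> k = of_int l \<longrightarrow>
            bij_betw
              (\<lambda>F. \<lambda>(z, \<theta>) \<in> UHPxR. of_real (Im z) powr (k / 2) * F z * exp (\<i> * k * of_real \<theta>))
              (maass_forms \<Gamma> g l lam) (Etilde \<Gamma> m k lam))"
proof (intro conjI ballI impI allI)
  fix f p assume f: "f \<in> invariants (Ecal \<Gamma> m k lam) Zt"
  then have smooth: "smooth_on UHPxR f"
    and "\<exists>n. \<forall>p\<in>UHPxR. ((\<lambda>h q. D_theta h q - \<i> * k * h q) ^^ n) f p = 0"
    by (simp_all add: Ecal_def invariants_def)
  then obtain n where nil: "\<forall>p\<in>UHPxR. ((\<lambda>h q. D_theta h q - \<i> * k * h q) ^^ n) f p = 0" by blast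
  have "\<forall>z\<in>UHP. \<forall>t. f (z, t + pi) = f (z, t)"
    using centre_invariant_periodic[OF f] by blast
  note eig = centre_invariant_eigenfunction[OF smooth nil this]
  assume "\<exists>p\<in>UHPxR. f p \<noteq> 0"
  then obtain z t where "z \<in> UHP" "f (z, t) \<noteq> 0" by (auto simp: UHPxR_def)
  then show "\<exists>l::int. even l \<and> k = of_int l" by (rule eig(3))
  assume "p \<in> UHPxR"
  then show "D_theta f p = \<i> * k * f p" using eig(1) by (auto simp: UHPxR_def)
next
  fix l :: int assume l: "even l \<and> k = of_int l"
  then obtain n where n: "l = 2 * n" by blast
  have k: "k = of_int (2 * n)" using l n by simp
  have \<Gamma>: "subgroup \<Gamma> PSL2R" using assms(1) by (simp add: cofinite_discrete_subgroup_def)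
  have g: "\<forall>\<kappa>\<in>cusps \<Gamma>. g \<kappa> \<in> carrier PSL2R" and m: "\<forall>\<kappa>\<in>cusps \<Gamma>. m \<kappa> \<in> g \<kappa>"
    using assms(2,3) by (auto simp: cusp_scaling_def)
  have map: "(\<lambda>(z, \<theta>) \<in> UHPxR. of_real (Im z) powr (k / 2) * F z * exp (\<i> * k * of_real \<theta>))
      = restrict (weight_lift n F) UHPxR" for F
    by (rule restrict_ext) (auto simp: weight_lift_def k complex_powr_of_int UHPxR_def UHP_def)
  note iff = weight_lift_in_Etilde_iff[OF subgroup.subset[OF \<Gamma>] g m]
  show "bij_betw
      (\<lambda>F. \<lambda>(z, \<theta>) \<in> UHPxR. of_real (Im z) powr (k / 2) * F z * exp (\<i> * k * of_real \<theta>))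
      (maass_forms \<Gamma> g l lam) (Etilde \<Gamma> m k lam)"
    unfolding map unfolding n k
  proof (rule bij_betw_imageI)
    show "inj_on (\<lambda>F. restrict (weight_lift n F) UHPxR) (maass_forms \<Gamma> g (2 * n) lam)"
    proof (rule inj_onI)
      fix F G assume FG: "F \<in> maass_forms \<Gamma> g (2 * n) lam" "G \<in> maass_forms \<Gamma> g (2 * n) lam"
        and eq: "restrict (weight_lift n F) UHPxR = restrict (weight_lift n G) UHPxR"
      show "F = G"
      proof (rule extensionalityI[of _ UHP])
        fix z assume z: "z \<in> UHP"
        have "weight_lift n F (z, 0) = 1 * weight_lift n G (z, 0)"
          using fun_cong[OF eq, of "(z, 0)"] z by simp
        then show "F z = G z" unfolding weight_lift_eq_iff[OF z] by simp
      qed (use FG in \<open>auto simp: maass_forms_def\<close>)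
    qed
    show "(\<lambda>F. restrict (weight_lift n F) UHPxR) ` maass_forms \<Gamma> g (2 * n) lam
        = Etilde \<Gamma> m (of_int (2 * n)) lam"
    proof (intro equalityI subsetI)
      fix f assume "f \<in> (\<lambda>F. restrict (weight_lift n F) UHPxR) ` maass_forms \<Gamma> g (2 * n) lam"
      then obtain F where F: "F \<in> maass_forms \<Gamma> g (2 * n) lam" "f = restrict (weight_lift n F) UHPxR" by blast
      then have "smooth_on UHP F" "F \<in> extensional UHP" by (simp_all add: maass_forms_def)
      from iff[OF this] F show "f \<in> Etilde \<Gamma> m (of_int (2 * n)) lam" by blast
    next
      fix f assume f: "f \<in> Etilde \<Gamma> m (of_int (2 * n)) lam"
      obtain F where F: "smooth_on UHP F" "F \<in> extensional UHP" "f = restrict (weight_lift n F) UHPxR"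
        using Etilde_is_weight_lift[OF \<Gamma> f] .
      with iff[OF F(1,2)] f show "f \<in> (\<lambda>F. restrict (weight_lift n F) UHPxR) ` maass_forms \<Gamma> g (2 * n) lam"
        by blast
    qed
  qed
qed

end
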